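(* Let $(K,d,\nu)$ be an $\alpha$-regular metric measure space with at least two points, satisfying the chain condition and such that all metric balls are relatively compact. Let $(\mathcal{E},\mathcal{F})$ be a conservative regular Dirichlet form on $L^2(K;\nu)$ with a heat kernel $p_t(x,y)$ satisfying $$\frac{C_1}{t^{\alpha/\beta_0}}\Phi\left(C_2\frac{d(x,y)}{t^{1/\beta_0}}\right)\le p_t(x,y)\le\frac{C_3}{t^{\alpha/\beta_0}}\Phi\left(C_4\frac{d(x,y)}{t^{1/\beta_0}}\right)$$ for any $x,y\in K$ and any $t\in(0,\mathrm{diam}(K)^{\beta_0})$, where $\mathrm{diam}(K)=\sup\{d(x,y):x,y\in K\}$ (infinite if $K$ is unbounded, finite if $K$ is bounded), $\beta_0\in(0,+\infty)$ is some parameter, $C_1,C_2,C_3,C_4$ are some positive constants and $\Phi:(0,+\infty)\to(0,+\infty)$ is some monotone decreasing function. For $\beta\in(0,+\infty)$ let $$\mathcal{F}_\beta=\left\{u\in L^2(K;\nu):\int_K\int_K\frac{(u(x)-u(y))^2}{d(x,y)^{\alpha+\beta}}\nu(\mathrm{d}x)\nu(\mathrm{d}y)<+\infty\right\}.$$ Then $$\mathcal{F}\subsetneqq\bigcap_{\beta\in(0,\beta_0)}\mathcal{F}_\beta .$$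
   Context: A metric measure space $(K,d,\nu)$: $(K,d)$ is a locally compact separable metric space and $\nu$ is a Radon measure on $K$ with full support. It is $\alpha$-regular ($\alpha>0$) if there is $C>0$ with $\frac1Cr^\alpha\le\nu(B(x,r))\le Cr^\alpha$ for all $x\in K$ and $r\in(0,\mathrm{diam}(K))$, where $B(x,r)$ is the metric ball. Chain condition: there is a constant $C>0$ such that for all $x,y\in K$ and every integer $n\ge1$ there are points $x=x_0,x_1,\ldots,x_n=y$ in $K$ with $d(x_{i-1},x_i)\le C\,d(x,y)/n$ for $i=1,\ldots,n$. Let $\{T_t:t>0\}$ be the strongly continuous Markovian semigroup on $L^2(K;\nu)$ corresponding to $(\mathcal{E},\mathcal{F})$. A heat kernel is a jointly measurable, symmetric, non-negative function $p_t(x,y)$ ($t>0$, $x,y\in K$) with $T_tu(x)=\int_Kp_t(x,y)u(y)\nu(\mathrm{d}y)$. Conservative means $\int_Kp_t(x,y)\nu(\mathrm{d}y)=1$ for all $t>0$ and $x\in K$. When $x=y$, $\Phi(0)$ is understood as $\lim_{s\downarrow0}\Phi(s)$. *)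

theory Defs
  imports "HOL-Analysis.Analysis"
begin

(* The space K is a whole type of class metric_space and second_countable_topology;
   for metric spaces, second countability is separability.
   Elements of L^2 are represented by Borel functions instead of by their a.e. classes. The
   domains F below are closed under a.e. modification, so (strict) inclusions between such sets of
   functions are the same as (strict) inclusions between the sets of classes. *)

definition radon_measure :: "'a::topological_space measure \<Rightarrow> bool" where
  "radon_measure \<nu> \<longleftrightarrow>
     sets \<nu> = sets borel \<and>
     (\<forall>S. compact S \<longrightarrow> emeasure \<nu> S < \<infinity>) \<and>
     (\<forall>A\<in>sets borel. emeasure \<nu> A = (INF U\<in>{U. open U \<and> A \<subseteq> U}. emeasure \<nu> U)) \<and>
     (\<forall>U. open U \<longrightarrow> emeasure \<nu> U = (SUP S\<in>{S. compact S \<and> S \<subseteq> U}. emeasure \<nu> S))"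

definition full_support :: "'a::topological_space measure \<Rightarrow> bool" where
  "full_support \<nu> \<longleftrightarrow> (\<forall>U. open U \<longrightarrow> U \<noteq> {} \<longrightarrow> emeasure \<nu> U > 0)"

definition metric_measure_space ::
    "'a::{metric_space, second_countable_topology} measure \<Rightarrow> bool" where
  "metric_measure_space \<nu> \<longleftrightarrow>
     locally_compact_space (euclidean :: 'a topology) \<and> radon_measure \<nu> \<and> full_support \<nu>"

(* The library's diameter is 0 on unbounded sets, hence the extended version. *)
definition ediameter :: "'a::metric_space set \<Rightarrow> ereal" where
  "ediameter S = (SUP x\<in>S. SUP y\<in>S. ereal (dist x y))"

(* Meant for nonnegative bases and positive exponents. *)
definition epowr :: "ereal \<Rightarrow> real \<Rightarrow> ereal" where
  "epowr a b = (if a = \<infinity> then \<infinity> else ereal (real_of_ereal a powr b))"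

definition regular_mms ::
    "real \<Rightarrow> 'a::{metric_space, second_countable_topology} measure \<Rightarrow> bool" where
  "regular_mms \<alpha> \<nu> \<longleftrightarrow> \<alpha> > 0 \<and> metric_measure_space \<nu> \<and>
     (\<exists>C>0. \<forall>x r. 0 < r \<and> ereal r < ediameter (UNIV :: 'a set) \<longrightarrow>
        ennreal (r powr \<alpha> / C) \<le> emeasure \<nu> (ball x r) \<and>
        emeasure \<nu> (ball x r) \<le> ennreal (C * r powr \<alpha>))"

definition chain_condition :: "'a::metric_space set \<Rightarrow> bool" where
  "chain_condition S \<longleftrightarrow>
     (\<exists>C>0. \<forall>x\<in>S. \<forall>y\<in>S. \<forall>n::nat. n \<ge> 1 \<longrightarrow>
        (\<exists>z :: nat \<Rightarrow> 'a. (\<forall>i\<le>n. z i \<in> S) \<and> z 0 = x \<and> z n = y \<and>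
           (\<forall>i\<in>{1..n}. dist (z (i - 1)) (z i) \<le> C * dist x y / real n)))"

definition L2 :: "'a measure \<Rightarrow> ('a \<Rightarrow> real) set" where
  "L2 \<nu> = {u \<in> borel_measurable \<nu>. integrable \<nu> (\<lambda>x. (u x)\<^sup>2)}"

definition L2_inner :: "'a measure \<Rightarrow> ('a \<Rightarrow> real) \<Rightarrow> ('a \<Rightarrow> real) \<Rightarrow> real" where
  "L2_inner \<nu> u v = (\<integral>x. u x * v x \<partial>\<nu>)"

definition L2_norm :: "'a measure \<Rightarrow> ('a \<Rightarrow> real) \<Rightarrow> real" where
  "L2_norm \<nu> u = sqrt (L2_inner \<nu> u u)"

definition symmetric_form ::
    "'a measure \<Rightarrow> (('a \<Rightarrow> real) \<Rightarrow> ('a \<Rightarrow> real) \<Rightarrow> real) \<Rightarrow> ('a \<Rightarrow> real) set \<Rightarrow> bool" where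
  "symmetric_form \<nu> E F \<longleftrightarrow>
     F \<subseteq> L2 \<nu> \<and>
     (\<lambda>x. 0) \<in> F \<and>
     (\<forall>u\<in>F. \<forall>v\<in>F. \<forall>a b. (\<lambda>x. a * u x + b * v x) \<in> F) \<and>
     (\<forall>u\<in>F. \<forall>v\<in>borel_measurable \<nu>. (AE x in \<nu>. u x = v x) \<longrightarrow>
        v \<in> F \<and> (\<forall>w\<in>F. E u w = E v w)) \<and>
     (\<forall>u\<in>L2 \<nu>. \<forall>\<epsilon>>0. \<exists>v\<in>F. L2_norm \<nu> (\<lambda>x. u x - v x) < \<epsilon>) \<and>
     (\<forall>u\<in>F. \<forall>v\<in>F. E u v = E v u) \<and>
     (\<forall>u\<in>F. \<forall>v\<in>F. \<forall>w\<in>F. \<forall>a b.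
        E (\<lambda>x. a * u x + b * v x) w = a * E u w + b * E v w) \<and>
     (\<forall>u\<in>F. E u u \<ge> 0)"

definition E1_norm ::
    "'a measure \<Rightarrow> (('a \<Rightarrow> real) \<Rightarrow> ('a \<Rightarrow> real) \<Rightarrow> real) \<Rightarrow> ('a \<Rightarrow> real) \<Rightarrow> real" where
  "E1_norm \<nu> E u = sqrt (E u u + L2_inner \<nu> u u)"

definition closed_form ::
    "'a measure \<Rightarrow> (('a \<Rightarrow> real) \<Rightarrow> ('a \<Rightarrow> real) \<Rightarrow> real) \<Rightarrow> ('a \<Rightarrow> real) set \<Rightarrow> bool" where
  "closed_form \<nu> E F \<longleftrightarrow>
     (\<forall>U :: nat \<Rightarrow> 'a \<Rightarrow> real. (\<forall>n. U n \<in> F) \<longrightarrow>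
        (\<forall>\<epsilon>>0. \<exists>N. \<forall>m\<ge>N. \<forall>n\<ge>N. E1_norm \<nu> E (\<lambda>x. U m x - U n x) < \<epsilon>) \<longrightarrow>
        (\<exists>u\<in>F. (\<lambda>n. E1_norm \<nu> E (\<lambda>x. U n x - u x)) \<longlonglongrightarrow> 0))"

definition markovian_form ::
    "(('a \<Rightarrow> real) \<Rightarrow> ('a \<Rightarrow> real) \<Rightarrow> real) \<Rightarrow> ('a \<Rightarrow> real) set \<Rightarrow> bool" where
  "markovian_form E F \<longleftrightarrow>
     (\<forall>u\<in>F. (\<lambda>x. min (max 0 (u x)) 1) \<in> F \<and>
        E (\<lambda>x. min (max 0 (u x)) 1) (\<lambda>x. min (max 0 (u x)) 1) \<le> E u u)"

definition dirichlet_form ::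
    "'a measure \<Rightarrow> (('a \<Rightarrow> real) \<Rightarrow> ('a \<Rightarrow> real) \<Rightarrow> real) \<Rightarrow> ('a \<Rightarrow> real) set \<Rightarrow> bool" where
  "dirichlet_form \<nu> E F \<longleftrightarrow> symmetric_form \<nu> E F \<and> closed_form \<nu> E F \<and> markovian_form E F"

definition Cc :: "('a::topological_space \<Rightarrow> real) set" where
  "Cc = {u. continuous_on UNIV u \<and> compact (closure {x. u x \<noteq> 0})}"

definition regular_form ::
    "'a::topological_space measure \<Rightarrow> (('a \<Rightarrow> real) \<Rightarrow> ('a \<Rightarrow> real) \<Rightarrow> real) \<Rightarrow>
     ('a \<Rightarrow> real) set \<Rightarrow> bool" where
  "regular_form \<nu> E F \<longleftrightarrow>
     (\<forall>u\<in>F. \<forall>\<epsilon>>0. \<exists>v\<in>F \<inter> Cc. E1_norm \<nu> E (\<lambda>x. u x - v x) < \<epsilon>) \<and>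
     (\<forall>u\<in>Cc. \<forall>\<epsilon>>0. \<exists>v\<in>F \<inter> Cc. \<forall>x. \<bar>u x - v x\<bar> < \<epsilon>)"

(* A strongly continuous semigroup of symmetric Markovian contractions on L^2. *)
definition markovian_semigroup ::
    "'a measure \<Rightarrow> (real \<Rightarrow> ('a \<Rightarrow> real) \<Rightarrow> 'a \<Rightarrow> real) \<Rightarrow> bool" where
  "markovian_semigroup \<nu> T \<longleftrightarrow>
     (\<forall>t>0. \<forall>u\<in>L2 \<nu>. T t u \<in> L2 \<nu>) \<and>
     (\<forall>t>0. \<forall>u\<in>L2 \<nu>. \<forall>v\<in>L2 \<nu>. \<forall>a b.
        AE x in \<nu>. T t (\<lambda>y. a * u y + b * v y) x = a * T t u x + b * T t v x) \<and>
     (\<forall>t>0. \<forall>u\<in>L2 \<nu>. \<forall>v\<in>L2 \<nu>. L2_inner \<nu> (T t u) v = L2_inner \<nu> u (T t v)) \<and>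
     (\<forall>t>0. \<forall>u\<in>L2 \<nu>. L2_norm \<nu> (T t u) \<le> L2_norm \<nu> u) \<and>
     (\<forall>s>0. \<forall>t>0. \<forall>u\<in>L2 \<nu>. AE x in \<nu>. T (s + t) u x = T s (T t u) x) \<and>
     (\<forall>u\<in>L2 \<nu>. ((\<lambda>t. L2_norm \<nu> (\<lambda>x. T t u x - u x)) \<longlongrightarrow> 0) (at_right 0)) \<and>
     (\<forall>t>0. \<forall>u\<in>L2 \<nu>. (AE x in \<nu>. 0 \<le> u x \<and> u x \<le> 1) \<longrightarrow>
        (AE x in \<nu>. 0 \<le> T t u x \<and> T t u x \<le> 1))"

(* u lies in the domain of the infinitesimal generator A of T, and A u = g. *)
definition generator_graph ::
    "'a measure \<Rightarrow> (real \<Rightarrow> ('a \<Rightarrow> real) \<Rightarrow> 'a \<Rightarrow> real) \<Rightarrow> ('a \<Rightarrow> real) \<Rightarrow> ('a \<Rightarrow> real) \<Rightarrow> bool" where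
  "generator_graph \<nu> T u g \<longleftrightarrow> u \<in> L2 \<nu> \<and> g \<in> L2 \<nu> \<and>
     ((\<lambda>t. L2_norm \<nu> (\<lambda>x. (T t u x - u x) / t - g x)) \<longlongrightarrow> 0) (at_right 0)"

(* The generator of T is the nonpositive self-adjoint operator A associated with the closed form:
   u is in D(A) with A u = g iff u is in F and E(u,v) = (-g,v) for all v in F. *)
definition semigroup_of_form ::
    "'a measure \<Rightarrow> (('a \<Rightarrow> real) \<Rightarrow> ('a \<Rightarrow> real) \<Rightarrow> real) \<Rightarrow> ('a \<Rightarrow> real) set \<Rightarrow>
     (real \<Rightarrow> ('a \<Rightarrow> real) \<Rightarrow> 'a \<Rightarrow> real) \<Rightarrow> bool" where
  "semigroup_of_form \<nu> E F T \<longleftrightarrow> markovian_semigroup \<nu> T \<and>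
     (\<forall>u\<in>L2 \<nu>. \<forall>g\<in>L2 \<nu>. generator_graph \<nu> T u g \<longleftrightarrow>
        u \<in> F \<and> (\<forall>v\<in>F. E u v = - L2_inner \<nu> g v))"

definition heat_kernel ::
    "'a measure \<Rightarrow> (real \<Rightarrow> ('a \<Rightarrow> real) \<Rightarrow> 'a \<Rightarrow> real) \<Rightarrow> (real \<Rightarrow> 'a \<Rightarrow> 'a \<Rightarrow> real) \<Rightarrow> bool" where
  "heat_kernel \<nu> T p \<longleftrightarrow>
     (\<forall>t>0. (\<lambda>(x, y). p t x y) \<in> borel_measurable (\<nu> \<Otimes>\<^sub>M \<nu>)) \<and>
     (\<forall>t>0. \<forall>x y. p t x y = p t y x) \<and>
     (\<forall>t>0. \<forall>x y. p t x y \<ge> 0) \<and>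
     (\<forall>t>0. \<forall>u\<in>L2 \<nu>. AE x in \<nu>.
        integrable \<nu> (\<lambda>y. p t x y * u y) \<and> T t u x = (\<integral>y. p t x y * u y \<partial>\<nu>))"

definition conservative_kernel :: "'a measure \<Rightarrow> (real \<Rightarrow> 'a \<Rightarrow> 'a \<Rightarrow> real) \<Rightarrow> bool" where
  "conservative_kernel \<nu> p \<longleftrightarrow> (\<forall>t>0. \<forall>x. (\<integral>\<^sup>+ y. ennreal (p t x y) \<partial>\<nu>) = 1)"

(* Phi is given on the positive reals only; its value at 0 is the limit at 0+, a priori possibly
   infinite, which is why the values are extended. *)
definition ext0 :: "(real \<Rightarrow> real) \<Rightarrow> real \<Rightarrow> ennreal" where
  "ext0 \<Phi> s = (if s > 0 then ennreal (\<Phi> s) else Lim (at_right 0) (\<lambda>r. ennreal (\<Phi> r)))"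

definition F_space :: "real \<Rightarrow> 'a::metric_space measure \<Rightarrow> real \<Rightarrow> ('a \<Rightarrow> real) set" where
  "F_space \<alpha> \<nu> \<beta> = {u \<in> L2 \<nu>.
     (\<integral>\<^sup>+ y. (\<integral>\<^sup>+ x. ennreal ((u x - u y)\<^sup>2 / dist x y powr (\<alpha> + \<beta>)) \<partial>\<nu>) \<partial>\<nu>) < \<infinity>}"

end

(* Put h_t(u) = (u,u) - (T_t u,u), so that 2 h_t(u) is the double integral of
   p_t(x,y) (u(x) - u(y))^2.

   If u lies in F, then h_t(u) <= 4 t E(u,u). The lower kernel bound turns this into a bound of order
   r^(alpha + beta0) for the integral of (u(x) - u(y))^2 over d(x,y) <= r, and summing over dyadic
   annuli gives u in F_beta for all beta < beta0.

   For strictness, smoothed indicators of balls of radius tau^(1/beta0) are functions v of norm at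
   most 1 with h_t(v) <= B t / tau for all t, but h_{A tau}(v) >= kappa. For tau_n = sigma s^(2n) with
   s small, the lacunary series u = sum_n +-(n+1) sqrt(tau_n) v_n with suitable signs lies in every
   F_beta, while h_t(u) / t is unbounded along t = A tau_n. *)

theory Submission
  imports Defs
begin

text \<open>Only a few inequalities are available for the bump functions v_n: they need not be
  orthogonal, and the mixed terms of h_t between different v_n may cancel the contribution at the
  scale where it should be large. Signs chosen one after another rule out cancellation by earlier
  terms; lacunarity makes the later terms so small in L^2 that the crude bound h_t(v) <= (v,v)
  disposes of them. The coefficients balance two demands: at t = A tau_n the quotient h_t(u)/t is at
  least of order (n+1)^2, while the F_beta energy of the n-th term is at most of order (n+1)^2
  tau_n^(1 - beta/beta0), geometrically small for every beta < beta0. The link between E and T_t is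
  the generator, so h_t is compared with E by splitting u with a resolvent; a factor larger than 1
  is the price of this elementary route instead of spectral calculus. The kernel bounds act at time
  r^beta0, as a lower bound of order r^(-alpha) for d(x,y) <= r and an upper bound of order
  r^(-alpha) throughout.\<close>

text \<open>Serves both Cauchy-Schwarz inequalities and, with a = 0, makes the first variation at a
  minimiser vanish. The degenerate case c = 0 must be covered, since the forms involved are only
  semidefinite.\<close>

lemma quadratic_nonneg_imp_discrim:
  fixes a b c :: real
  assumes "\<And>s. 0 \<le> a + 2 * s * b + s\<^sup>2 * c" "0 \<le> c"
  shows "b\<^sup>2 \<le> a * c"
proof (cases "c = 0")
  case True
  have "b = 0"
  proof (rule ccontr)
    assume "b \<noteq> 0"
    \<comment> \<open>At this s the expression a + 2 s b equals -1.\<close>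
    with assms(1)[of "- (a + 1) / (2 * b)"] True show False
      by (simp add: field_simps)
  qed
  with True show ?thesis by simp
next
  case False
  with assms have c: "c > 0" by simp
  have "0 \<le> c * (a + 2 * (- b / c) * b + (- b / c)\<^sup>2 * c)"
    using assms(1)[of "- b / c"] c by (intro mult_nonneg_nonneg) auto
  also have "\<dots> = a * c - b\<^sup>2"
    using c by (simp add: field_simps power2_eq_square)
  finally show ?thesis by simp
qed

subsection \<open>Square integrable functions\<close>

lemma L2_measurable: "u \<in> L2 \<nu> \<Longrightarrow> u \<in> borel_measurable \<nu>"
  by (simp add: L2_def)

lemma L2_mult_integrable:
  assumes "u \<in> L2 \<nu>" "v \<in> L2 \<nu>"
  shows "integrable \<nu> (\<lambda>x. u x * v x)"
proof (rule Bochner_Integration.integrable_bound)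
  show "integrable \<nu> (\<lambda>x. (u x)\<^sup>2 + (v x)\<^sup>2)"
    using assms by (simp add: L2_def)
  show "(\<lambda>x. u x * v x) \<in> borel_measurable \<nu>"
    using assms by (auto simp: L2_def)
  have "\<bar>a * b\<bar> \<le> a\<^sup>2 + b\<^sup>2" for a b :: real
  proof -
    have "2 * \<bar>a\<bar> * \<bar>b\<bar> \<le> a\<^sup>2 + b\<^sup>2"
      using sum_squares_bound[of "\<bar>a\<bar>" "\<bar>b\<bar>"] by simp
    moreover have "0 \<le> \<bar>a\<bar> * \<bar>b\<bar>" by simp
    ultimately show ?thesis unfolding abs_mult by linarith
  qed
  then show "AE x in \<nu>. norm (u x * v x) \<le> norm ((u x)\<^sup>2 + (v x)\<^sup>2)"
    by simp
qed

lemma L2_zero: "(\<lambda>x. 0) \<in> L2 \<nu>"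
  by (simp add: L2_def)

lemma L2_lincomb:
  assumes "u \<in> L2 \<nu>" "v \<in> L2 \<nu>"
  shows "(\<lambda>x. a * u x + b * v x) \<in> L2 \<nu>"
proof -
  have "integrable \<nu> (\<lambda>x. a\<^sup>2 * (u x)\<^sup>2 + 2 * a * b * (u x * v x) + b\<^sup>2 * (v x)\<^sup>2)"
    using assms L2_mult_integrable[OF assms] by (simp add: L2_def)
  also have "(\<lambda>x. a\<^sup>2 * (u x)\<^sup>2 + 2 * a * b * (u x * v x) + b\<^sup>2 * (v x)\<^sup>2) = (\<lambda>x. (a * u x + b * v x)\<^sup>2)"
    by (auto simp: power2_eq_square algebra_simps)
  finally show ?thesis using assms by (auto simp: L2_def)
qed

lemma L2_diff: "u \<in> L2 \<nu> \<Longrightarrow> v \<in> L2 \<nu> \<Longrightarrow> (\<lambda>x. u x - v x) \<in> L2 \<nu>"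
  using L2_lincomb[of u \<nu> v 1 "-1"] by simp

lemma L2_add: "u \<in> L2 \<nu> \<Longrightarrow> v \<in> L2 \<nu> \<Longrightarrow> (\<lambda>x. u x + v x) \<in> L2 \<nu>"
  using L2_lincomb[of u \<nu> v 1 "1"] by simp

lemma L2_scale: "u \<in> L2 \<nu> \<Longrightarrow> (\<lambda>x. a * u x) \<in> L2 \<nu>"
  using L2_lincomb[of u \<nu> u a 0] by simp

lemma L2_inner_commute: "L2_inner \<nu> u v = L2_inner \<nu> v u"
  by (simp add: L2_inner_def mult.commute)

lemma L2_inner_lincomb_left:
  assumes "u \<in> L2 \<nu>" "v \<in> L2 \<nu>" "w \<in> L2 \<nu>"
  shows "L2_inner \<nu> (\<lambda>x. a * u x + b * v x) w = a * L2_inner \<nu> u w + b * L2_inner \<nu> v w"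
proof -
  have "L2_inner \<nu> (\<lambda>x. a * u x + b * v x) w = (\<integral>x. a * (u x * w x) + b * (v x * w x) \<partial>\<nu>)"
    by (simp add: L2_inner_def algebra_simps)
  then show ?thesis
    using L2_mult_integrable[OF assms(1,3)] L2_mult_integrable[OF assms(2,3)]
    by (simp add: L2_inner_def)
qed

lemma L2_inner_lincomb_right:
  assumes "u \<in> L2 \<nu>" "v \<in> L2 \<nu>" "w \<in> L2 \<nu>"
  shows "L2_inner \<nu> w (\<lambda>x. a * u x + b * v x) = a * L2_inner \<nu> w u + b * L2_inner \<nu> w v"
  using L2_inner_lincomb_left[OF assms] by (simp add: L2_inner_commute)

lemma L2_inner_nonneg: "0 \<le> L2_inner \<nu> u u"
  by (simp add: L2_inner_def)

lemma L2_inner_lincomb_self: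
  assumes "u \<in> L2 \<nu>" "v \<in> L2 \<nu>"
  shows "L2_inner \<nu> (\<lambda>x. a * u x + b * v x) (\<lambda>x. a * u x + b * v x)
    = a\<^sup>2 * L2_inner \<nu> u u + 2 * a * b * L2_inner \<nu> u v + b\<^sup>2 * L2_inner \<nu> v v"
  using assms
  by (simp add: L2_inner_lincomb_left L2_inner_lincomb_right L2_lincomb L2_inner_commute[of _ v u]
      power2_eq_square algebra_simps)

lemma L2_inner_diff_self:
  assumes "u \<in> L2 \<nu>" "v \<in> L2 \<nu>"
  shows "L2_inner \<nu> (\<lambda>x. u x - v x) (\<lambda>x. u x - v x)
    = L2_inner \<nu> u u - 2 * L2_inner \<nu> u v + L2_inner \<nu> v v"
  using L2_inner_lincomb_self[OF assms, of 1 "-1"] by simp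

lemma L2_inner_diff_left:
  assumes "u \<in> L2 \<nu>" "v \<in> L2 \<nu>" "w \<in> L2 \<nu>"
  shows "L2_inner \<nu> (\<lambda>x. u x - v x) w = L2_inner \<nu> u w - L2_inner \<nu> v w"
  using L2_inner_lincomb_left[OF assms, of 1 "-1"] by simp

lemma L2_inner_cong_AE:
  assumes "AE x in \<nu>. u x = u' x" "u \<in> borel_measurable \<nu>" "u' \<in> borel_measurable \<nu>"
    "w \<in> borel_measurable \<nu>"
  shows "L2_inner \<nu> u w = L2_inner \<nu> u' w"
  unfolding L2_inner_def
proof (rule integral_cong_AE)
  show "AE x in \<nu>. u x * w x = u' x * w x"
    using assms(1) by eventually_elim simp
qed (use assms in auto)

lemma L2_Cauchy_Schwarz:
  assumes "u \<in> L2 \<nu>" "v \<in> L2 \<nu>"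
  shows "\<bar>L2_inner \<nu> u v\<bar> \<le> L2_norm \<nu> u * L2_norm \<nu> v"
proof -
  have "(L2_inner \<nu> u v)\<^sup>2 \<le> L2_inner \<nu> u u * L2_inner \<nu> v v"
  proof (rule quadratic_nonneg_imp_discrim)
    fix s :: real
    show "0 \<le> L2_inner \<nu> u u + 2 * s * L2_inner \<nu> u v + s\<^sup>2 * L2_inner \<nu> v v"
      using L2_inner_lincomb_self[OF assms, of 1 s] L2_inner_nonneg[of \<nu> "\<lambda>x. u x + s * v x"]
      by simp
  qed (rule L2_inner_nonneg)
  then have "sqrt ((L2_inner \<nu> u v)\<^sup>2) \<le> sqrt (L2_inner \<nu> u u * L2_inner \<nu> v v)"
    by (rule real_sqrt_le_mono)
  then show ?thesis
    by (simp add: L2_norm_def real_sqrt_mult)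
qed

subsection \<open>Symmetric Markovian semigroups\<close>

locale L2_semigroup =
  fixes \<nu> :: "'a measure" and T :: "real \<Rightarrow> ('a \<Rightarrow> real) \<Rightarrow> 'a \<Rightarrow> real"
  assumes semigroup: "markovian_semigroup \<nu> T"
begin

lemmas semigroup_conjs = semigroup[unfolded markovian_semigroup_def]

lemma T_L2: "t > 0 \<Longrightarrow> u \<in> L2 \<nu> \<Longrightarrow> T t u \<in> L2 \<nu>"
  using semigroup_conjs[THEN conjunct1] by simp

text \<open>Linearity of \<open>T t\<close> is given only almost everywhere; pairing with w turns it
  into an exact identity. The semigroup law is treated in the same way in
  \<open>T_T_inner\<close>.\<close>

lemma T_lincomb:
  assumes "t > 0" "u \<in> L2 \<nu>" "v \<in> L2 \<nu>" "w \<in> L2 \<nu>"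
  shows "L2_inner \<nu> (T t (\<lambda>x. a * u x + b * v x)) w
    = a * L2_inner \<nu> (T t u) w + b * L2_inner \<nu> (T t v) w"
proof -
  have "L2_inner \<nu> (T t (\<lambda>x. a * u x + b * v x)) w
    = L2_inner \<nu> (\<lambda>x. a * T t u x + b * T t v x) w"
  proof (rule L2_inner_cong_AE)
    show "AE x in \<nu>. T t (\<lambda>x. a * u x + b * v x) x = a * T t u x + b * T t v x"
      using semigroup_conjs[THEN conjunct2, THEN conjunct1] assms by simp
  qed (use assms in \<open>auto intro!: L2_measurable T_L2 L2_lincomb\<close>)
  with assms show ?thesis by (simp add: L2_inner_lincomb_left T_L2)
qed

lemma T_symmetric:
  "t > 0 \<Longrightarrow> u \<in> L2 \<nu> \<Longrightarrow> v \<in> L2 \<nu> \<Longrightarrow> L2_inner \<nu> (T t u) v = L2_inner \<nu> u (T t v)"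
  using semigroup_conjs[THEN conjunct2, THEN conjunct2, THEN conjunct1] by simp

lemma T_contraction:
  assumes "t > 0" "u \<in> L2 \<nu>"
  shows "L2_inner \<nu> (T t u) (T t u) \<le> L2_inner \<nu> u u"
proof -
  have "L2_norm \<nu> (T t u) \<le> L2_norm \<nu> u"
    using semigroup_conjs[THEN conjunct2, THEN conjunct2, THEN conjunct2, THEN conjunct1] assms by simp
  then show ?thesis by (simp add: L2_norm_def)
qed

lemma T_T_inner:
  assumes "s > 0" "t > 0" "u \<in> L2 \<nu>" "v \<in> L2 \<nu>"
  shows "L2_inner \<nu> (T s u) (T t v) = L2_inner \<nu> (T (s + t) u) v"
proof -
  have "L2_inner \<nu> (T (t + s) u) v = L2_inner \<nu> (T t (T s u)) v"
  proof (rule L2_inner_cong_AE)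
    show "AE x in \<nu>. T (t + s) u x = T t (T s u) x"
      using semigroup_conjs[THEN conjunct2, THEN conjunct2, THEN conjunct2, THEN conjunct2, THEN conjunct1] assms by simp
  qed (use assms in \<open>auto intro!: L2_measurable T_L2\<close>)
  also have "\<dots> = L2_inner \<nu> (T s u) (T t v)"
    using assms by (intro T_symmetric T_L2)
  finally show ?thesis by (simp add: add.commute)
qed

lemma T_half_norm: "t > 0 \<Longrightarrow> u \<in> L2 \<nu> \<Longrightarrow> L2_inner \<nu> (T (t/2) u) (T (t/2) u) = L2_inner \<nu> (T t u) u"
  using T_T_inner[of "t/2" "t/2" u u] by simp

lemma T_inner_nonneg: "t > 0 \<Longrightarrow> u \<in> L2 \<nu> \<Longrightarrow> 0 \<le> L2_inner \<nu> (T t u) u"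
  using T_half_norm[of t u] by (metis L2_inner_nonneg)

lemma T_inner_le: "t > 0 \<Longrightarrow> u \<in> L2 \<nu> \<Longrightarrow> L2_inner \<nu> (T t u) u \<le> L2_inner \<nu> u u"
  using T_half_norm[of t u] T_contraction[of "t/2" u] by simp

text \<open>Multiplied by \<open>1/t\<close>, this is the usual approximation of the form at time \<open>t\<close>.\<close>

definition defect :: "real \<Rightarrow> ('a \<Rightarrow> real) \<Rightarrow> real" where
  "defect t u = L2_inner \<nu> u u - L2_inner \<nu> (T t u) u"

lemma defect_nonneg: "t > 0 \<Longrightarrow> u \<in> L2 \<nu> \<Longrightarrow> 0 \<le> defect t u"
  by (simp add: defect_def T_inner_le)

lemma defect_le: "t > 0 \<Longrightarrow> u \<in> L2 \<nu> \<Longrightarrow> defect t u \<le> L2_inner \<nu> u u"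
  by (simp add: defect_def T_inner_nonneg)

lemma defect_lincomb:
  assumes "t > 0" "u \<in> L2 \<nu>" "v \<in> L2 \<nu>"
  shows "defect t (\<lambda>x. a * u x + b * v x)
    = a\<^sup>2 * defect t u + 2 * a * b * (L2_inner \<nu> u v - L2_inner \<nu> (T t u) v) + b\<^sup>2 * defect t v"
proof -
  have "L2_inner \<nu> (T t v) u = L2_inner \<nu> (T t u) v"
    using assms T_symmetric[of t v u] by (simp add: L2_inner_commute)
  with assms show ?thesis
    by (simp add: defect_def L2_inner_lincomb_self T_lincomb L2_inner_lincomb_right T_L2
        L2_lincomb power2_eq_square algebra_simps)
qed

lemma defect_parallelogram:
  assumes "t > 0" "u \<in> L2 \<nu>" "v \<in> L2 \<nu>"
  shows "defect t (\<lambda>x. u x + a * v x) + defect t (\<lambda>x. u x - a * v x)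
    = 2 * defect t u + 2 * a\<^sup>2 * defect t v"
  using defect_lincomb[OF assms, of 1 a] defect_lincomb[OF assms, of 1 "-a"] by simp

text \<open>Nonnegativity of the defect of a u - b v bounds the mixed term by the two pure
  ones.\<close>

lemma defect_add_le:
  assumes "t > 0" "u \<in> L2 \<nu>" "v \<in> L2 \<nu>"
  shows "defect t (\<lambda>x. a * u x + b * v x) \<le> 2 * a\<^sup>2 * defect t u + 2 * b\<^sup>2 * defect t v"
proof -
  have "0 \<le> a\<^sup>2 * defect t u - 2 * a * b * (L2_inner \<nu> u v - L2_inner \<nu> (T t u) v) + b\<^sup>2 * defect t v"
    using defect_nonneg[OF assms(1) L2_lincomb[OF assms(2,3), of a "-b"]]
    unfolding defect_lincomb[OF assms] by simp
  then show ?thesis unfolding defect_lincomb[OF assms] mult.assoc[of 2 "_\<^sup>2"] by linarith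
qed

text \<open>The gap between the two sides is the squared norm of u - T_t u.\<close>

lemma defect_double:
  assumes "t > 0" "u \<in> L2 \<nu>"
  shows "defect (2 * t) u \<le> 2 * defect t u"
proof -
  have "0 \<le> L2_inner \<nu> (\<lambda>x. u x - T t u x) (\<lambda>x. u x - T t u x)"
    by (rule L2_inner_nonneg)
  also have "\<dots> = L2_inner \<nu> u u - 2 * L2_inner \<nu> (T t u) u + L2_inner \<nu> (T (2 * t) u) u"
    using assms T_T_inner[of t t u u] by (simp add: L2_inner_diff_self T_L2 L2_inner_commute)
  finally show ?thesis by (simp add: defect_def)
qed

text \<open>Hence h_t(u)/t can only grow along t, t/2, t/4, ..., so a limit at time 0 along this
  sequence bounds the quotient at the initial t.\<close>

lemma defect_halving:
  assumes "t > 0" "u \<in> L2 \<nu>"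
  shows "defect t u \<le> 2 ^ n * defect (t / 2 ^ n) u"
proof (induction n)
  case (Suc n)
  have "defect (t / 2 ^ n) u \<le> 2 * defect (t / 2 ^ Suc n) u"
    using defect_double[of "t / 2 ^ Suc n" u] assms by (simp add: field_simps)
  then have "2 ^ n * defect (t / 2 ^ n) u \<le> 2 ^ Suc n * defect (t / 2 ^ Suc n) u"
    by simp
  with Suc.IH show ?case by (rule order_trans)
qed simp

text \<open>The second difference of b -> (T_b u,u) at a, a + t, a + 2t is the squared norm of
  T_(a/2) u - T_(a/2+t) u.\<close>

lemma T_inner_convex:
  assumes "a > 0" "t > 0" "u \<in> L2 \<nu>"
  shows "L2_inner \<nu> (T (a + t) u) u - L2_inner \<nu> (T (a + t + t) u) u
    \<le> L2_inner \<nu> (T a u) u - L2_inner \<nu> (T (a + t) u) u"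
proof -
  have "0 \<le> L2_inner \<nu> (\<lambda>x. T (a/2) u x - T (a/2 + t) u x) (\<lambda>x. T (a/2) u x - T (a/2 + t) u x)"
    by (rule L2_inner_nonneg)
  also have "\<dots> = L2_inner \<nu> (T a u) u - 2 * L2_inner \<nu> (T (a + t) u) u
      + L2_inner \<nu> (T (a + t + t) u) u"
    using assms T_T_inner[of "a/2" "a/2" u u] T_T_inner[of "a/2" "a/2+t" u u]
      T_T_inner[of "a/2+t" "a/2+t" u u]
    by (simp add: L2_inner_diff_self T_L2 add_ac)
  finally show ?thesis by simp
qed

text \<open>By convexity the decrements over consecutive steps of length t do not increase. Each of
  the m decrements between a and a + m t is therefore at least the one that follows a + m t, and
  they telescope.\<close>

lemma T_inner_decrement:
  fixes a t :: real and m :: nat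
  assumes "a > 0" "t > 0" "u \<in> L2 \<nu>"
  shows "real m * (L2_inner \<nu> (T (a + real m * t) u) u - L2_inner \<nu> (T (a + real m * t + t) u) u)
    \<le> L2_inner \<nu> (T a u) u - L2_inner \<nu> (T (a + real m * t) u) u"
proof (induction m)
  case (Suc m)
  define k where "k b = L2_inner \<nu> (T b u) u" for b
  have eq: "a + real (Suc m) * t = a + m * t + t"
    by (simp add: algebra_simps)
  have *: "k (a + m * t + t) - k (a + m * t + t + t) \<le> k (a + m * t) - k (a + m * t + t)"
    using T_inner_convex[of "a + m * t" t u] assms
    by (simp add: k_def add_pos_nonneg)
  then have "real m * (k (a + m * t + t) - k (a + m * t + t + t))
      \<le> real m * (k (a + m * t) - k (a + m * t + t))"
    by (rule mult_left_mono) simp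
  with * Suc show ?case unfolding k_def[symmetric] eq
    by (simp add: algebra_simps)
qed simp

text \<open>Reads the defect of a smoothed function as one decrement of the convex function b ->
  (T_b f,f), starting at time 2s.\<close>

lemma defect_T:
  assumes "s > 0" "t > 0" "f \<in> L2 \<nu>"
  shows "defect t (T s f) = L2_inner \<nu> (T (2 * s) f) f - L2_inner \<nu> (T (2 * s + t) f) f"
proof -
  have "L2_inner \<nu> (T t (T s f)) (T s f) = L2_inner \<nu> (T s f) (T t (T s f))"
    by (rule L2_inner_commute)
  also have "\<dots> = L2_inner \<nu> (T (s + t) f) (T s f)"
    using assms by (simp add: T_T_inner T_L2)
  also have "\<dots> = L2_inner \<nu> (T (2 * s + t) f) f"
    using assms T_T_inner[of "s + t" s f f] by (simp add: add_ac)
  finally show ?thesis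
    using T_T_inner[of s s f f] assms by (simp add: defect_def)
qed

text \<open>Smoothing: convexity of \<open>t \<mapsto> (T\<^sub>t f, f)\<close> replaces the spectral theorem.\<close>

lemma defect_smoothed_le:
  assumes "s > 0" "t > 0" "f \<in> L2 \<nu>"
  shows "defect t (T s f) \<le> t / s * L2_inner \<nu> f f"
proof (cases "t \<le> s")
  case False
  have "defect t (T s f) \<le> L2_inner \<nu> f f"
    using defect_le[of t "T s f"] T_contraction[of s f] T_L2 assms by fastforce
  also have "\<dots> \<le> t / s * L2_inner \<nu> f f"
    using False assms mult_right_mono[of 1 "t / s" "L2_inner \<nu> f f"] L2_inner_nonneg[of \<nu> f]
    by simp
  finally show ?thesis .
next
  case True
  define k where "k b = L2_inner \<nu> (T b f) f" for b
  \<comment> \<open>The largest m for which a = 2s - m t is still positive, since T is available at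
    positive times only. From t <= s follows m >= 2s/t - 1 >= s/t.\<close>
  define m where "m = nat \<lceil>2 * s / t\<rceil> - 1"
  have ge2: "2 * s / t \<ge> 2" using True assms by (simp add: field_simps)
  then have m: "real m = of_int \<lceil>2 * s / t\<rceil> - 1" unfolding m_def by linarith
  define a where "a = 2 * s - m * t"
  have "m < 2 * s / t" using m by linarith
  then have "m * t < 2 * s" using assms by (simp add: field_simps)
  then have a: "a > 0" by (simp add: a_def)
  have "m \<ge> s / t" using m ge2 by linarith
  have d: "defect t (T s f) = k (2 * s) - k (2 * s + t)"
    using defect_T[OF assms] by (simp add: k_def)
  have "s / t * defect t (T s f) \<le> m * defect t (T s f)"
    using \<open>m \<ge> s / t\<close> defect_nonneg[of t "T s f"] assms by (intro mult_right_mono) (auto intro: T_L2)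
  also have "\<dots> = m * (k (a + m * t) - k (a + m * t + t))"
    unfolding d by (simp add: a_def)
  also have "\<dots> \<le> k a - k (a + m * t)"
    unfolding k_def using T_inner_decrement[OF a assms(2,3), of m] by simp
  also have "\<dots> \<le> L2_inner \<nu> f f"
    using T_inner_le[of a f] T_inner_nonneg[of "a + m * t" f] a assms
    by (simp add: k_def add_pos_nonneg)
  finally show ?thesis using assms by (simp add: field_simps)
qed

end

subsection \<open>Closed forms\<close>

locale closed_form_semigroup =
  fixes \<nu> :: "'a measure" and E :: "('a \<Rightarrow> real) \<Rightarrow> ('a \<Rightarrow> real) \<Rightarrow> real"
    and F :: "('a \<Rightarrow> real) set" and T :: "real \<Rightarrow> ('a \<Rightarrow> real) \<Rightarrow> 'a \<Rightarrow> real"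
  assumes symmetric: "symmetric_form \<nu> E F"
    and closed: "closed_form \<nu> E F"
    and form_semigroup: "semigroup_of_form \<nu> E F T"
begin

sublocale L2_semigroup \<nu> T
  using form_semigroup by unfold_locales (simp add: semigroup_of_form_def)

lemma F_L2: "u \<in> F \<Longrightarrow> u \<in> L2 \<nu>"
  using symmetric unfolding symmetric_form_def by blast

lemma F_lincomb: "u \<in> F \<Longrightarrow> v \<in> F \<Longrightarrow> (\<lambda>x. a * u x + b * v x) \<in> F"
  using symmetric unfolding symmetric_form_def by blast

lemma F_diff: "u \<in> F \<Longrightarrow> v \<in> F \<Longrightarrow> (\<lambda>x. u x - v x) \<in> F"
  using F_lincomb[of u v 1 "-1"] by simp

lemma zero_in_F: "(\<lambda>x. 0) \<in> F"
  using symmetric unfolding symmetric_form_def by blast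

lemma E_commute: "u \<in> F \<Longrightarrow> v \<in> F \<Longrightarrow> E u v = E v u"
  using symmetric unfolding symmetric_form_def by blast

lemma E_nonneg: "u \<in> F \<Longrightarrow> 0 \<le> E u u"
  using symmetric unfolding symmetric_form_def by blast

lemma E_lincomb_left:
  "u \<in> F \<Longrightarrow> v \<in> F \<Longrightarrow> w \<in> F \<Longrightarrow> E (\<lambda>x. a * u x + b * v x) w = a * E u w + b * E v w"
  using symmetric unfolding symmetric_form_def by blast

text \<open>The form usually written E_\<mu>; for \<mu> > 0 its norm is equivalent to
  \<open>E1_norm\<close>.\<close>

definition shifted :: "real \<Rightarrow> ('a \<Rightarrow> real) \<Rightarrow> ('a \<Rightarrow> real) \<Rightarrow> real" where
  "shifted \<mu> u v = E u v + \<mu> * L2_inner \<nu> u v"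

lemma shifted_nonneg: "\<mu> \<ge> 0 \<Longrightarrow> u \<in> F \<Longrightarrow> 0 \<le> shifted \<mu> u u"
  by (simp add: shifted_def E_nonneg L2_inner_nonneg)

lemma shifted_commute: "u \<in> F \<Longrightarrow> v \<in> F \<Longrightarrow> shifted \<mu> u v = shifted \<mu> v u"
  by (simp add: shifted_def E_commute[of u v] L2_inner_commute)

lemma shifted_lincomb_left:
  "u \<in> F \<Longrightarrow> v \<in> F \<Longrightarrow> w \<in> F \<Longrightarrow>
    shifted \<mu> (\<lambda>x. a * u x + b * v x) w = a * shifted \<mu> u w + b * shifted \<mu> v w"
  by (simp add: shifted_def E_lincomb_left L2_inner_lincomb_left F_L2 algebra_simps)

lemma shifted_lincomb_self:
  assumes "u \<in> F" "v \<in> F"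
  shows "shifted \<mu> (\<lambda>x. a * u x + b * v x) (\<lambda>x. a * u x + b * v x)
    = a\<^sup>2 * shifted \<mu> u u + 2 * a * b * shifted \<mu> u v + b\<^sup>2 * shifted \<mu> v v"
  using assms
  by (simp add: shifted_lincomb_left shifted_commute[of _ "\<lambda>x. a * u x + b * v x"] F_lincomb
      shifted_commute[of v u] power2_eq_square algebra_simps)

lemma shifted_Cauchy_Schwarz:
  assumes "\<mu> \<ge> 0" "u \<in> F" "v \<in> F"
  shows "(shifted \<mu> u v)\<^sup>2 \<le> shifted \<mu> u u * shifted \<mu> v v"
proof (rule quadratic_nonneg_imp_discrim)
  fix s :: real
  show "0 \<le> shifted \<mu> u u + 2 * s * shifted \<mu> u v + s\<^sup>2 * shifted \<mu> v v"
    using shifted_lincomb_self[OF assms(2,3), of \<mu> 1 s]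
      shifted_nonneg[OF assms(1) F_lincomb[OF assms(2,3), of 1 s]] by simp
qed (use assms in \<open>simp add: shifted_nonneg\<close>)

lemma E_Cauchy_Schwarz: "u \<in> F \<Longrightarrow> v \<in> F \<Longrightarrow> (E u v)\<^sup>2 \<le> E u u * E v v"
  using shifted_Cauchy_Schwarz[of 0 u v] by (simp add: shifted_def)

text \<open>Closedness concerns the shift 1. The constants M and M' compare the shifts 1 and \<mu>
  in both directions: M carries the Cauchy property over, M' carries the convergence back.\<close>

lemma closed_shifted:
  assumes "\<mu> > 0" "\<And>n. U n \<in> F"
    and "\<And>\<epsilon>. \<epsilon> > 0 \<Longrightarrow> \<exists>N. \<forall>m\<ge>N. \<forall>n\<ge>N. shifted \<mu> (\<lambda>x. U m x - U n x) (\<lambda>x. U m x - U n x) < \<epsilon>"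
  shows "\<exists>w\<in>F. (\<lambda>n. shifted \<mu> (\<lambda>x. U n x - w x) (\<lambda>x. U n x - w x)) \<longlonglongrightarrow> 0"
proof -
  define M where "M = max 1 (1 / \<mu>)"
  define M' where "M' = max 1 \<mu>"
  have M: "M > 0" by (simp add: M_def)
  have E1: "(E1_norm \<nu> E u)\<^sup>2 = shifted 1 u u" if "u \<in> F" for u
    using that by (simp add: E1_norm_def shifted_def E_nonneg L2_inner_nonneg)
  have le: "shifted 1 u u \<le> M * shifted \<mu> u u" if "u \<in> F" for u
  proof -
    have "1 * E u u \<le> M * E u u"
      using E_nonneg[OF that] by (intro mult_right_mono) (auto simp: M_def)
    moreover have "1 * L2_inner \<nu> u u \<le> (M * \<mu>) * L2_inner \<nu> u u"
      using assms(1) by (intro mult_right_mono L2_inner_nonneg)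
        (auto simp: M_def max_def field_simps)
    ultimately show ?thesis by (simp add: shifted_def algebra_simps)
  qed
  have le': "shifted \<mu> u u \<le> M' * shifted 1 u u" if "u \<in> F" for u
  proof -
    have "1 * E u u \<le> M' * E u u"
      using E_nonneg[OF that] by (intro mult_right_mono) (auto simp: M'_def)
    moreover have "\<mu> * L2_inner \<nu> u u \<le> M' * L2_inner \<nu> u u"
      by (intro mult_right_mono L2_inner_nonneg) (auto simp: M'_def)
    ultimately show ?thesis by (simp add: shifted_def algebra_simps)
  qed
  have "\<exists>N. \<forall>m\<ge>N. \<forall>n\<ge>N. E1_norm \<nu> E (\<lambda>x. U m x - U n x) < \<epsilon>" if "\<epsilon> > 0" for \<epsilon>
  proof -
    obtain N where N: "\<And>m n. m \<ge> N \<Longrightarrow> n \<ge> N \<Longrightarrow>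
        shifted \<mu> (\<lambda>x. U m x - U n x) (\<lambda>x. U m x - U n x) < \<epsilon>\<^sup>2 / M"
      using assms(3)[of "\<epsilon>\<^sup>2 / M"] \<open>\<epsilon> > 0\<close> M by auto
    have "E1_norm \<nu> E (\<lambda>x. U m x - U n x) < \<epsilon>" if "m \<ge> N" "n \<ge> N" for m n
    proof -
      have d: "(\<lambda>x. U m x - U n x) \<in> F" by (intro F_diff assms)
      have "M * shifted \<mu> (\<lambda>x. U m x - U n x) (\<lambda>x. U m x - U n x) < \<epsilon>\<^sup>2"
        using N[OF that] M by (simp add: field_simps)
      then have "(E1_norm \<nu> E (\<lambda>x. U m x - U n x))\<^sup>2 < \<epsilon>\<^sup>2"
        using le[OF d] unfolding E1[OF d] by linarith
      then show ?thesis using \<open>\<epsilon> > 0\<close> by (simp add: power2_less_imp_less)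
    qed
    then show ?thesis by blast
  qed
  then obtain w where w: "w \<in> F" and lim: "(\<lambda>n. E1_norm \<nu> E (\<lambda>x. U n x - w x)) \<longlonglongrightarrow> 0"
    using closed assms(2) unfolding closed_form_def by blast
  have d: "(\<lambda>x. U n x - w x) \<in> F" for n by (intro F_diff assms w)
  have "(\<lambda>n. shifted \<mu> (\<lambda>x. U n x - w x) (\<lambda>x. U n x - w x)) \<longlonglongrightarrow> 0"
  proof (rule tendsto_sandwich)
    show "\<forall>\<^sub>F n in sequentially. 0 \<le> shifted \<mu> (\<lambda>x. U n x - w x) (\<lambda>x. U n x - w x)"
      using d assms(1) by (simp add: shifted_nonneg)
    show "\<forall>\<^sub>F n in sequentially. shifted \<mu> (\<lambda>x. U n x - w x) (\<lambda>x. U n x - w x)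
        \<le> M' * (E1_norm \<nu> E (\<lambda>x. U n x - w x))\<^sup>2"
      using le' d E1 by simp
    show "(\<lambda>n. M' * (E1_norm \<nu> E (\<lambda>x. U n x - w x))\<^sup>2) \<longlonglongrightarrow> 0"
      using tendsto_mult[OF tendsto_const[of M'] tendsto_power[OF lim, of 2]] by simp
  qed simp
  with w show ?thesis by blast
qed

text \<open>Riesz representation in \<open>F\<close>: the functional \<open>w \<mapsto> \<E>\<^sub>\<mu>(w,w) - 2(u,w)\<close> is minimised.\<close>

lemma resolvent_exists:
  assumes lam: "\<mu> > 0" and u: "u \<in> L2 \<nu>"
  obtains w where "w \<in> F" "\<And>v. v \<in> F \<Longrightarrow> shifted \<mu> w v = L2_inner \<nu> u v"
proof -
  define J where "J w = shifted \<mu> w w - 2 * L2_inner \<nu> u w" for w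
  \<comment> \<open>Completing the square: \<mu> (w,w) - 2 (u,w) + (u,u)/\<mu> is the squared norm
    of \<mu> w - u divided by \<mu>.\<close>
  have lower: "J w \<ge> - L2_inner \<nu> u u / \<mu>" if w: "w \<in> F" for w
  proof -
    have "0 \<le> \<mu>\<^sup>2 * L2_inner \<nu> w w - 2 * \<mu> * L2_inner \<nu> w u + L2_inner \<nu> u u"
      using L2_inner_lincomb_self[OF F_L2[OF w] u, of \<mu> "-1"]
        L2_inner_nonneg[of \<nu> "\<lambda>x. \<mu> * w x + - 1 * u x"] by simp
    also have "\<dots> = \<mu> * (\<mu> * L2_inner \<nu> w w - 2 * L2_inner \<nu> u w + L2_inner \<nu> u u / \<mu>)"
      using lam by (simp add: L2_inner_commute[of _ w u] field_simps power2_eq_square)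
    finally have "0 \<le> \<mu> * L2_inner \<nu> w w - 2 * L2_inner \<nu> u w + L2_inner \<nu> u u / \<mu>"
      using lam by (simp add: zero_le_mult_iff)
    then show ?thesis using E_nonneg[OF w] by (simp add: J_def shifted_def)
  qed
  define m where "m = Inf (J ` F)"
  have bdd: "bdd_below (J ` F)" using lower by (auto intro!: bdd_belowI)
  have m: "m \<le> J w" if "w \<in> F" for w
    unfolding m_def using bdd that by (intro cInf_lower) auto
  have "\<exists>w\<in>F. J w < m + 1 / Suc n" for n
    using cInf_lessD[of "J ` F" "m + 1 / Suc n"] zero_in_F by (auto simp: m_def)
  then obtain W where W: "\<And>n. W n \<in> F" "\<And>n. J (W n) < m + 1 / Suc n"
    by metis
  \<comment> \<open>By the parallelogram law the left side equals 2 J(a) + 2 J(b) - 4 J((a+b)/2);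
    hence minimising sequences are Cauchy.\<close>
  have Jpar: "shifted \<mu> (\<lambda>x. a x - b x) (\<lambda>x. a x - b x) \<le> 2 * J a + 2 * J b - 4 * m"
    if "a \<in> F" "b \<in> F" for a b
  proof -
    have "m \<le> J (\<lambda>x. (1/2) * a x + (1/2) * b x)"
      by (intro m F_lincomb that)
    also have "\<dots> = (1/4) * shifted \<mu> a a + (1/2) * shifted \<mu> a b + (1/4) * shifted \<mu> b b
        - (L2_inner \<nu> u a + L2_inner \<nu> u b)"
      using that u shifted_lincomb_self[OF that, of \<mu> "1/2" "1/2"]
        L2_inner_lincomb_right[OF F_L2[OF that(1)] F_L2[OF that(2)] u, of "1/2" "1/2"]
      by (simp add: J_def power2_eq_square)
    finally show ?thesis
      using shifted_lincomb_self[OF that, of \<mu> 1 "-1"] by (simp add: J_def)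
  qed
  have "\<exists>w\<in>F. (\<lambda>n. shifted \<mu> (\<lambda>x. W n x - w x) (\<lambda>x. W n x - w x)) \<longlonglongrightarrow> 0"
  proof (rule closed_shifted[OF lam W(1)])
    fix \<epsilon> :: real assume "\<epsilon> > 0"
    then obtain N where N: "1 / Suc N < \<epsilon> / 4"
      using nat_approx_posE[of "\<epsilon> / 4"] by auto
    have "shifted \<mu> (\<lambda>x. W i x - W j x) (\<lambda>x. W i x - W j x) < \<epsilon>" if "i \<ge> N" "j \<ge> N" for i j
    proof -
      have "1 / real (Suc i) \<le> 1 / Suc N" "1 / real (Suc j) \<le> 1 / Suc N"
        using that by (auto intro!: divide_left_mono)
      then show ?thesis
        using Jpar[OF W(1)[of i] W(1)[of j]] W(2)[of i] W(2)[of j] N by linarith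
    qed
    then show "\<exists>N. \<forall>i\<ge>N. \<forall>j\<ge>N. shifted \<mu> (\<lambda>x. W i x - W j x) (\<lambda>x. W i x - W j x) < \<epsilon>"
      by blast
  qed
  then obtain w where w: "w \<in> F"
    and lim: "(\<lambda>n. shifted \<mu> (\<lambda>x. W n x - w x) (\<lambda>x. W n x - w x)) \<longlonglongrightarrow> 0" by blast
  have "shifted \<mu> w v = L2_inner \<nu> u v" if v: "v \<in> F" for v
  proof -
    have "(\<lambda>n. shifted \<mu> (\<lambda>x. W n x - w x) v) \<longlonglongrightarrow> 0"
    proof (rule Lim_null_comparison)
      show "\<forall>\<^sub>F n in sequentially. norm (shifted \<mu> (\<lambda>x. W n x - w x) v)
        \<le> sqrt (shifted \<mu> (\<lambda>x. W n x - w x) (\<lambda>x. W n x - w x) * shifted \<mu> v v)"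
        using shifted_Cauchy_Schwarz[OF _ F_diff[OF W(1) w] v, of \<mu>] lam
        by (intro always_eventually allI real_le_rsqrt) (auto simp: power2_abs)
      show "(\<lambda>n. sqrt (shifted \<mu> (\<lambda>x. W n x - w x) (\<lambda>x. W n x - w x) * shifted \<mu> v v)) \<longlonglongrightarrow> 0"
        using tendsto_real_sqrt[OF tendsto_mult[OF lim tendsto_const[of "shifted \<mu> v v"]]] by simp
    qed
    then have "(\<lambda>n. shifted \<mu> (\<lambda>x. W n x - w x) v + shifted \<mu> w v) \<longlonglongrightarrow> 0 + shifted \<mu> w v"
      by (intro tendsto_intros)
    moreover have "shifted \<mu> (\<lambda>x. W n x - w x) v = shifted \<mu> (W n) v - shifted \<mu> w v" for n
      using shifted_lincomb_left[OF W(1)[of n] w v, of \<mu> 1 "-1"] by simp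
    ultimately have Wv: "(\<lambda>n. shifted \<mu> (W n) v) \<longlonglongrightarrow> shifted \<mu> w v"
      by simp
    \<comment> \<open>First variation. Minimality is tested along W_n + s v, where J(W_n) < m +
      1/(n+1), and the error vanishes in the limit. A nonnegative quadratic in s with constant term
      0 has linear coefficient 0.\<close>
    define D where "D = shifted \<mu> w v - L2_inner \<nu> u v"
    have "D\<^sup>2 \<le> 0 * shifted \<mu> v v"
    proof (rule quadratic_nonneg_imp_discrim)
      fix s :: real
      have "0 \<le> 1 / Suc n + 2 * s * (shifted \<mu> (W n) v - L2_inner \<nu> u v) + s\<^sup>2 * shifted \<mu> v v" for n
      proof -
        have "m \<le> J (\<lambda>x. 1 * W n x + s * v x)"
          by (intro m F_lincomb W v)
        also have "\<dots> = J (W n) + 2 * s * (shifted \<mu> (W n) v - L2_inner \<nu> u v) + s\<^sup>2 * shifted \<mu> v v"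
          unfolding J_def
          using shifted_lincomb_self[OF W(1)[of n] v, of \<mu> 1 s]
            L2_inner_lincomb_right[OF F_L2[OF W(1)[of n]] F_L2[OF v] u, of 1 s]
          by (simp add: algebra_simps)
        finally show ?thesis using W(2)[of n] by linarith
      qed
      moreover have "(\<lambda>n. 1 / Suc n + 2 * s * (shifted \<mu> (W n) v - L2_inner \<nu> u v) + s\<^sup>2 * shifted \<mu> v v)
          \<longlonglongrightarrow> 0 + 2 * s * D + s\<^sup>2 * shifted \<mu> v v"
        unfolding D_def by (intro tendsto_intros Wv LIMSEQ_Suc[OF lim_1_over_n])
      ultimately show "0 \<le> 0 + 2 * s * D + s\<^sup>2 * shifted \<mu> v v"
        by (intro LIMSEQ_le_const) auto
    qed (use lam v in \<open>simp add: shifted_nonneg\<close>)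
    then show ?thesis by (simp add: D_def)
  qed
  with w that show thesis by blast
qed

text \<open>Halving replaces h_s(w)/s by the larger h_t(w)/t with t = s/2^n. This quotient is -((T_t
  w - w)/t, w), which tends to -(g,w) as t tends to 0.\<close>

lemma defect_generator:
  assumes "generator_graph \<nu> T w g" "s > 0"
  shows "defect s w \<le> - s * L2_inner \<nu> g w"
proof -
  have w: "w \<in> L2 \<nu>" and g: "g \<in> L2 \<nu>"
    and lim: "((\<lambda>t. L2_norm \<nu> (\<lambda>x. (T t w x - w x) / t - g x)) \<longlongrightarrow> 0) (at_right 0)"
    using assms(1) by (auto simp: generator_graph_def)
  define t where "t n = s / 2 ^ n" for n :: nat
  have tpos: "t n > 0" for n using assms by (simp add: t_def)
  have "(\<lambda>n. s * (1 / 2) ^ n) \<longlonglongrightarrow> s * 0"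
    by (intro tendsto_intros LIMSEQ_realpow_zero) auto
  then have "t \<longlonglongrightarrow> 0" by (simp add: t_def[abs_def] power_divide)
  then have "filterlim t (at_right 0) sequentially"
    using tpos less_imp_neq[OF tpos, symmetric] by (simp add: filterlim_at)
  from filterlim_compose[OF lim this]
  have lim': "(\<lambda>n. L2_norm \<nu> (\<lambda>x. (T (t n) w x - w x) / t n - g x)) \<longlonglongrightarrow> 0" .
  have q: "L2_inner \<nu> (\<lambda>x. (T (t n) w x - w x) / t n - g x) w
      = - defect (t n) w / t n - L2_inner \<nu> g w"
    and qL2: "(\<lambda>x. (T (t n) w x - w x) / t n - g x) \<in> L2 \<nu>" for n
  proof -
    have 1: "(\<lambda>x. (1 / t n) * T (t n) w x + (- 1 / t n) * w x) \<in> L2 \<nu>"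
      by (intro L2_lincomb T_L2 tpos w)
    have eq: "(\<lambda>x. (T (t n) w x - w x) / t n - g x)
        = (\<lambda>x. ((1 / t n) * T (t n) w x + (- 1 / t n) * w x) - g x)"
      by (auto simp: diff_divide_distrib)
    show "L2_inner \<nu> (\<lambda>x. (T (t n) w x - w x) / t n - g x) w
      = - defect (t n) w / t n - L2_inner \<nu> g w"
      unfolding eq L2_inner_diff_left[OF 1 g w]
        L2_inner_lincomb_left[OF T_L2[OF tpos w] w w]
      by (simp add: defect_def diff_divide_distrib)
    show "(\<lambda>x. (T (t n) w x - w x) / t n - g x) \<in> L2 \<nu>"
      unfolding eq by (intro L2_diff 1 g)
  qed
  have "defect s w / s \<le> - L2_inner \<nu> g w + L2_norm \<nu> (\<lambda>x. (T (t n) w x - w x) / t n - g x) * L2_norm \<nu> w" for n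
  proof -
    have "defect s w / s \<le> defect (t n) w / t n"
      using defect_halving[OF assms(2) w, of n] assms(2) by (simp add: t_def field_simps)
    also have "\<dots> = - L2_inner \<nu> g w - L2_inner \<nu> (\<lambda>x. (T (t n) w x - w x) / t n - g x) w"
      unfolding q by simp
    also have "\<dots> \<le> - L2_inner \<nu> g w + \<bar>L2_inner \<nu> (\<lambda>x. (T (t n) w x - w x) / t n - g x) w\<bar>"
      by simp
    finally show ?thesis using L2_Cauchy_Schwarz[OF qL2 w, of n] by linarith
  qed
  moreover have "(\<lambda>n. - L2_inner \<nu> g w + L2_norm \<nu> (\<lambda>x. (T (t n) w x - w x) / t n - g x) * L2_norm \<nu> w)
      \<longlonglongrightarrow> - L2_inner \<nu> g w + 0 * L2_norm \<nu> w"
    by (intro tendsto_intros lim')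
  ultimately have "defect s w / s \<le> - L2_inner \<nu> g w + 0 * L2_norm \<nu> w"
    by (intro LIMSEQ_le_const) auto
  with assms(2) show ?thesis by (simp add: field_simps)
qed

text \<open>Splitting \<open>u = \<mu>w - Aw\<close> with \<open>\<mu> = 1/s\<close> and \<open>w\<close> in the domain of the generator \<open>A\<close>.\<close>

lemma defect_le_form:
  assumes u: "u \<in> F" and s: "s > 0"
  shows "defect s u \<le> 4 * s * E u u"
proof -
  define \<mu> where "\<mu> = 1 / s"
  have lam: "\<mu> > 0" using s by (simp add: \<mu>_def)
  obtain w where w: "w \<in> F" and res: "\<And>v. v \<in> F \<Longrightarrow> shifted \<mu> w v = L2_inner \<nu> u v"
    using resolvent_exists[OF lam F_L2[OF u]] by blast
  define g where "g = (\<lambda>x. \<mu> * w x + (-1) * u x)"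
  have uL: "u \<in> L2 \<nu>" and wL: "w \<in> L2 \<nu>" using u w F_L2 by auto
  have g: "g \<in> L2 \<nu>" unfolding g_def by (intro L2_lincomb uL wL)
  have gin: "L2_inner \<nu> g v = \<mu> * L2_inner \<nu> w v - L2_inner \<nu> u v" if "v \<in> L2 \<nu>" for v
    unfolding g_def L2_inner_lincomb_left[OF wL uL that] by simp
  have Ew: "E w v = - L2_inner \<nu> g v" if "v \<in> F" for v
    using res[OF that] gin[OF F_L2[OF that]] by (simp add: shifted_def)
  have gen: "generator_graph \<nu> T w g"
    using form_semigroup wL g w Ew unfolding semigroup_of_form_def by blast
  \<comment> \<open>E(u,w) controls both parts of the splitting: \<open>gg\<close> exhibits it as
    (g,g) + \<mu> E(w,w), and Cauchy-Schwarz for E then gives X^2 <= E(u,u) s X.\<close>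
  define X where "X = E u w"
  have X: "X = L2_inner \<nu> u u - \<mu> * L2_inner \<nu> w u"
    using Ew[OF u] E_commute[OF u w] gin[OF uL] by (simp add: X_def)
  have gg: "L2_inner \<nu> g g + \<mu> * E w w = X"
  proof -
    have "L2_inner \<nu> g g = \<mu> * L2_inner \<nu> g w + - 1 * L2_inner \<nu> g u"
      using L2_inner_lincomb_right[OF wL uL g, of \<mu> "-1"] unfolding g_def[symmetric] .
    then show ?thesis using Ew[OF w] gin[OF uL] X by simp
  qed
  have "0 \<le> \<mu> * E w w" using E_nonneg[OF w] lam by simp
  then have gg_le: "L2_inner \<nu> g g \<le> X" and Eww: "\<mu> * E w w \<le> X"
    using gg L2_inner_nonneg[of \<nu> g] by linarith+
  have X0: "X \<ge> 0" using gg_le L2_inner_nonneg[of \<nu> g] by linarith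
  have "X\<^sup>2 \<le> E u u * E w w" using E_Cauchy_Schwarz[OF u w] by (simp add: X_def)
  also have "\<dots> \<le> E u u * (s * X)"
    using Eww s E_nonneg[OF u] by (intro mult_left_mono) (auto simp: \<mu>_def field_simps)
  finally have XE: "X \<le> s * E u u"
    using X0 E_nonneg[OF u] s by (cases "X = 0") (auto simp: power2_eq_square mult.commute)
  have "u = (\<lambda>x. \<mu> * w x + (-1) * g x)" by (auto simp: g_def)
  then have "defect s u \<le> 2 * \<mu>\<^sup>2 * defect s w + 2 * defect s g"
    using defect_add_le[OF s wL g, of \<mu> "-1"] by simp
  \<comment> \<open>The part w is estimated through the generator, where E(w,w) = -(g,w); the
    remainder g by h_s(g) <= (g,g).\<close>
  also have "\<dots> \<le> 2 * \<mu>\<^sup>2 * (s * E w w) + 2 * L2_inner \<nu> g g"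
    using defect_generator[OF gen s] Ew[OF w] defect_le[OF s g]
    by (intro add_mono mult_left_mono) auto
  also have "2 * \<mu>\<^sup>2 * (s * E w w) = 2 * (\<mu> * E w w)"
    using s by (simp add: \<mu>_def power2_eq_square)
  also have "2 * (\<mu> * E w w) + 2 * L2_inner \<nu> g g = 2 * X" using gg by simp
  finally show ?thesis using XE X0 by simp
qed

end

subsection \<open>Heat kernel estimates\<close>

lemma ex_dyadic_scale:
  fixes x :: real
  assumes "1 \<le> x"
  obtains j :: nat where "2 ^ j \<le> x" "x < 2 ^ Suc j"
proof -
  define n where "n = (LEAST n. x < 2 ^ n)"
  obtain m where "x < 2 ^ m" using real_arch_pow[of 2 x] by auto
  then have n: "x < 2 ^ n" unfolding n_def by (rule LeastI)
  with assms obtain j where j: "n = Suc j" by (cases n) auto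
  then have "\<not> x < 2 ^ j" unfolding n_def by (intro not_less_Least) simp
  with n j show thesis by (intro that[of j]) auto
qed

lemma suminf_ennreal_geometric:
  fixes q C :: real
  assumes "0 \<le> C" "0 \<le> q" "q < 1"
  shows "(\<Sum>j. ennreal (C * q ^ j)) = ennreal (C / (1 - q))"
proof -
  have "(\<lambda>j. q ^ j) sums (1 / (1 - q))"
    using assms by (intro geometric_sums) simp
  from sums_mult[OF this, of C] show ?thesis
    using assms by (intro suminf_ennreal_eq) auto
qed

text \<open>Everything is indexed by a length r, with r^\<beta>0 as the corresponding time, so that
  no profile \<Phi> remains. R limits the lengths at which the kernel estimates and the lower volume
  bound are available; the upper volume bound is wanted for every r because the far annuli have
  unbounded radius.\<close>

locale heat_kernel_estimates = L2_semigroup \<nu> T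
  for \<nu> :: "'a::{metric_space, second_countable_topology} measure" and T +
  fixes p :: "real \<Rightarrow> 'a \<Rightarrow> 'a \<Rightarrow> real" and \<alpha> \<beta>0 c M V R :: real
  assumes sets_eq: "sets \<nu> = sets borel"
    and sigma_finite_nu: "sigma_finite_measure \<nu>"
    and kernel: "heat_kernel \<nu> T p" and conservative: "conservative_kernel \<nu> p"
    and pos: "\<alpha> > 0" "\<beta>0 > 0" "c > 0" "M > 0" "V > 0" "R > 0"
    and kernel_lower: "\<And>r x y. 0 < r \<Longrightarrow> r < R \<Longrightarrow> dist x y \<le> r \<Longrightarrow>
        c * r powr (- \<alpha>) \<le> p (r powr \<beta>0) x y"
    and kernel_upper: "\<And>r x y. 0 < r \<Longrightarrow> r < R \<Longrightarrow> p (r powr \<beta>0) x y \<le> M * r powr (- \<alpha>)"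
    and ball_upper: "\<And>r x. 0 < r \<Longrightarrow> emeasure \<nu> (ball x r) \<le> ennreal (V * r powr \<alpha>)"
    and ball_lower: "\<And>r x. 0 < r \<Longrightarrow> r < R \<Longrightarrow> ennreal (r powr \<alpha> / V) \<le> emeasure \<nu> (ball x r)"
begin

sublocale pair_sigma_finite \<nu> \<nu>
  using sigma_finite_nu by (intro pair_sigma_finite.intro)

declare sets_eq [measurable_cong]

lemma kernel_measurable: "t > 0 \<Longrightarrow> (\<lambda>(x, y). p t x y) \<in> borel_measurable (\<nu> \<Otimes>\<^sub>M \<nu>)"
  using kernel unfolding heat_kernel_def by blast

lemma kernel_symmetric: "t > 0 \<Longrightarrow> p t x y = p t y x"
  using kernel unfolding heat_kernel_def by blast

lemma kernel_nonneg: "t > 0 \<Longrightarrow> 0 \<le> p t x y"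
  using kernel unfolding heat_kernel_def by blast

lemma kernel_AE:
  "t > 0 \<Longrightarrow> u \<in> L2 \<nu> \<Longrightarrow> AE x in \<nu>. integrable \<nu> (\<lambda>y. p t x y * u y) \<and> T t u x = (\<integral>y. p t x y * u y \<partial>\<nu>)"
  using kernel unfolding heat_kernel_def by blast

lemma kernel_mass: "t > 0 \<Longrightarrow> (\<integral>\<^sup>+ y. ennreal (p t x y) \<partial>\<nu>) = 1"
  using conservative by (simp add: conservative_kernel_def)

lemma nn_integral_L2: "u \<in> L2 \<nu> \<Longrightarrow> (\<integral>\<^sup>+ x. ennreal ((u x)\<^sup>2) \<partial>\<nu>) = ennreal (L2_inner \<nu> u u)"
  by (simp add: L2_def L2_inner_def power2_eq_square nn_integral_eq_integral)

text \<open>When the square is expanded, conservativeness and symmetry turn both pure terms into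
  (u,u), and the mixed term is (T_t u,u). The terms may be separated because each is integrable on
  the product, the mixed one being dominated by the pure ones.\<close>

lemma defect_kernel:
  assumes t: "t > 0" and u: "u \<in> L2 \<nu>"
  shows "(\<integral>\<^sup>+ y. (\<integral>\<^sup>+ x. ennreal (p t x y * (u x - u y)\<^sup>2) \<partial>\<nu>) \<partial>\<nu>) = ennreal (2 * defect t u)"
proof -
  let ?P = "\<nu> \<Otimes>\<^sub>M \<nu>"
  note [measurable] = L2_measurable[OF u]
  have [measurable]: "(\<lambda>z. p t (fst z) (snd z)) \<in> borel_measurable ?P"
    using kernel_measurable[OF t] by (simp add: case_prod_beta')
  have [measurable]: "p t x \<in> borel_measurable \<nu>" for x
    using measurable_compose[OF measurable_Pair1' kernel_measurable[OF t], of x] sets_eq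
    by (simp add: sets_eq_imp_space_eq)
  define f1 where "f1 z = p t (fst z) (snd z) * (u (fst z))\<^sup>2" for z
  define f2 where "f2 z = p t (fst z) (snd z) * (u (snd z))\<^sup>2" for z
  define f3 where "f3 z = p t (fst z) (snd z) * (u (fst z) * u (snd z))" for z
  have [measurable]: "f1 \<in> borel_measurable ?P" "f2 \<in> borel_measurable ?P" "f3 \<in> borel_measurable ?P"
    unfolding f1_def f2_def f3_def by measurable
  have nonneg: "f1 z \<ge> 0" "f2 z \<ge> 0" for z
    by (auto simp: f1_def f2_def kernel_nonneg t)
  have sq: "(\<integral>\<^sup>+ x. (\<integral>\<^sup>+ y. ennreal (p t x y * (u x)\<^sup>2) \<partial>\<nu>) \<partial>\<nu>) = ennreal (L2_inner \<nu> u u)"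
  proof -
    have "(\<integral>\<^sup>+ y. ennreal (p t x y * (u x)\<^sup>2) \<partial>\<nu>) = ennreal ((u x)\<^sup>2)" for x
      by (simp add: ennreal_mult'' nn_integral_multc kernel_mass t)
    then show ?thesis by (simp add: nn_integral_L2 u)
  qed
  have i1: "(\<integral>\<^sup>+ z. ennreal (f1 z) \<partial>?P) = ennreal (L2_inner \<nu> u u)"
    using sq sigma_finite_measure.nn_integral_fst[OF sigma_finite_nu, of "\<lambda>z. ennreal (f1 z)" \<nu>]
    by (simp add: f1_def)
  have i2: "(\<integral>\<^sup>+ z. ennreal (f2 z) \<partial>?P) = ennreal (L2_inner \<nu> u u)"
    using sq by (simp add: nn_integral_snd[symmetric] f2_def kernel_symmetric[OF t, of _ "_::'a"])
  have int1: "integrable ?P f1" and int2: "integrable ?P f2"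
    using i1 i2 nonneg by (auto intro!: integrableI_nonneg)
  have val1: "integral\<^sup>L ?P f1 = L2_inner \<nu> u u" and val2: "integral\<^sup>L ?P f2 = L2_inner \<nu> u u"
    using i1 i2 nonneg by (auto simp: integral_eq_nn_integral L2_inner_nonneg)
  have int3: "integrable ?P f3"
  proof (rule Bochner_Integration.integrable_bound)
    show "integrable ?P (\<lambda>z. f1 z + f2 z)" using int1 int2 by simp
    have "norm (f3 z) \<le> norm (f1 z + f2 z)" for z
    proof -
      have "2 * \<bar>u (fst z)\<bar> * \<bar>u (snd z)\<bar> \<le> (u (fst z))\<^sup>2 + (u (snd z))\<^sup>2"
        using sum_squares_bound[of "\<bar>u (fst z)\<bar>" "\<bar>u (snd z)\<bar>"] by simp
      moreover have "0 \<le> \<bar>u (fst z)\<bar> * \<bar>u (snd z)\<bar>" by simp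
      ultimately have "\<bar>u (fst z)\<bar> * \<bar>u (snd z)\<bar> \<le> (u (fst z))\<^sup>2 + (u (snd z))\<^sup>2" by linarith
      then have "p t (fst z) (snd z) * (\<bar>u (fst z)\<bar> * \<bar>u (snd z)\<bar>)
          \<le> p t (fst z) (snd z) * ((u (fst z))\<^sup>2 + (u (snd z))\<^sup>2)"
        by (intro mult_left_mono kernel_nonneg t)
      then show ?thesis
        by (simp add: f1_def f2_def f3_def abs_mult kernel_nonneg t distrib_left)
    qed
    then show "AE z in ?P. norm (f3 z) \<le> norm (f1 z + f2 z)" by simp
  qed simp
  have val3: "integral\<^sup>L ?P f3 = L2_inner \<nu> (T t u) u"
  proof -
    have "integral\<^sup>L ?P f3 = (\<integral>x. (\<integral>y. f3 (x, y) \<partial>\<nu>) \<partial>\<nu>)"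
      using integral_fst'[OF int3] by simp
    also have "\<dots> = L2_inner \<nu> (T t u) u"
      unfolding L2_inner_def
    proof (rule integral_cong_AE)
      show "AE x in \<nu>. (\<integral>y. f3 (x, y) \<partial>\<nu>) = T t u x * u x"
        using kernel_AE[OF t u]
      proof eventually_elim
        case (elim x)
        have "(\<integral>y. f3 (x, y) \<partial>\<nu>) = (\<integral>y. u x * (p t x y * u y) \<partial>\<nu>)"
          by (simp add: f3_def mult_ac)
        with elim show ?case by simp
      qed
    qed (use L2_measurable[OF T_L2[OF t u]] in measurable)
    finally show ?thesis .
  qed
  define f where "f z = f1 z + f2 z - 2 * f3 z" for z
  have f: "f (x, y) = p t x y * (u x - u y)\<^sup>2" for x y
    by (simp add: f_def f1_def f2_def f3_def power2_eq_square algebra_simps)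
  have "(\<integral>\<^sup>+ y. (\<integral>\<^sup>+ x. ennreal (p t x y * (u x - u y)\<^sup>2) \<partial>\<nu>) \<partial>\<nu>) = (\<integral>\<^sup>+ z. ennreal (f z) \<partial>?P)"
    unfolding f[symmetric] by (rule nn_integral_snd) (simp add: f_def)
  also have "\<dots> = ennreal (integral\<^sup>L ?P f)"
  proof (rule nn_integral_eq_integral)
    show "integrable ?P f" unfolding f_def using int1 int2 int3 by auto
    have "0 \<le> f z" for z using f[of "fst z" "snd z"] by (simp add: kernel_nonneg t)
    then show "AE z in ?P. 0 \<le> f z" by simp
  qed
  also have "integral\<^sup>L ?P f = 2 * defect t u"
    unfolding f_def using int1 int2 int3 by (simp add: val1 val2 val3 defect_def)
  finally show ?thesis .
qed

text \<open>At time r^\<beta>0 the kernel is at least c r^(-\<alpha>) wherever d(x,y) <= r, so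
  r^\<alpha>/c times the kernel dominates the indicator of that set. The factor 2 comes from
  \<open>defect_kernel\<close>.\<close>

lemma near_diagonal_energy:
  assumes u: "u \<in> L2 \<nu>" and r: "0 < r" "r < R"
  shows "(\<integral>\<^sup>+ y. (\<integral>\<^sup>+ x. ennreal (if dist x y \<le> r then (u x - u y)\<^sup>2 else 0) \<partial>\<nu>) \<partial>\<nu>)
    \<le> ennreal (2 / c * r powr \<alpha> * defect (r powr \<beta>0) u)"
proof -
  let ?t = "r powr \<beta>0"
  have t: "?t > 0" using r by simp
  note [measurable] = L2_measurable[OF u]
  have [measurable]: "(\<lambda>z. p ?t (fst z) (snd z)) \<in> borel_measurable (\<nu> \<Otimes>\<^sub>M \<nu>)"
    using kernel_measurable[OF t] by (simp add: case_prod_beta')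
  have meas: "(\<lambda>(x, y). ennreal (p ?t x y * (u x - u y)\<^sup>2)) \<in> borel_measurable (\<nu> \<Otimes>\<^sub>M \<nu>)"
    unfolding case_prod_beta' by measurable
  have "(\<integral>\<^sup>+ y. (\<integral>\<^sup>+ x. ennreal (if dist x y \<le> r then (u x - u y)\<^sup>2 else 0) \<partial>\<nu>) \<partial>\<nu>)
    \<le> (\<integral>\<^sup>+ y. (\<integral>\<^sup>+ x. ennreal (r powr \<alpha> / c) * ennreal (p ?t x y * (u x - u y)\<^sup>2) \<partial>\<nu>) \<partial>\<nu>)"
  proof (intro nn_integral_mono)
    fix x y
    have "(u x - u y)\<^sup>2 \<le> r powr \<alpha> / c * (p ?t x y * (u x - u y)\<^sup>2)" if "dist x y \<le> r"
    proof -
      have "r powr \<alpha> / c * (c * r powr (- \<alpha>)) \<le> r powr \<alpha> / c * p ?t x y"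
        using kernel_lower[OF r that] pos by (intro mult_left_mono) auto
      moreover have "r powr \<alpha> / c * (c * r powr (- \<alpha>)) = 1"
        using r pos by (simp add: powr_minus)
      ultimately have "1 * (u x - u y)\<^sup>2 \<le> (r powr \<alpha> / c * p ?t x y) * (u x - u y)\<^sup>2"
        by (intro mult_right_mono) auto
      then show ?thesis by (simp add: mult_ac)
    qed
    then have "(if dist x y \<le> r then (u x - u y)\<^sup>2 else 0) \<le> r powr \<alpha> / c * (p ?t x y * (u x - u y)\<^sup>2)"
      using pos t by (auto simp: kernel_nonneg)
    then show "ennreal (if dist x y \<le> r then (u x - u y)\<^sup>2 else 0)
        \<le> ennreal (r powr \<alpha> / c) * ennreal (p ?t x y * (u x - u y)\<^sup>2)"
      using pos by (subst ennreal_mult'[symmetric]) (auto intro: ennreal_leI)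
  qed
  also have "\<dots> = ennreal (r powr \<alpha> / c) * ennreal (2 * defect ?t u)"
  proof -
    have "(\<lambda>x. ennreal (p ?t x y * (u x - u y)\<^sup>2)) \<in> borel_measurable \<nu>" for y
      using measurable_compose[OF measurable_Pair2' meas, of y] sets_eq
      by (simp add: sets_eq_imp_space_eq)
    moreover have "(\<lambda>y. \<integral>\<^sup>+ x. ennreal (p ?t x y * (u x - u y)\<^sup>2) \<partial>\<nu>) \<in> borel_measurable \<nu>"
      by (rule sigma_finite_measure.borel_measurable_nn_integral[OF sigma_finite_nu])
        (simp add: case_prod_beta' kernel_symmetric[OF t, of "snd z" for z :: "'a \<times> 'a"])
    ultimately show ?thesis
      unfolding defect_kernel[OF t u, symmetric] by (simp add: nn_integral_cmult)
  qed
  also have "\<dots> = ennreal (2 / c * r powr \<alpha> * defect ?t u)"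
    using pos by (subst ennreal_mult'[symmetric]) (auto simp: mult_ac)
  finally show ?thesis .
qed

text \<open>Crude bound for scales beyond the reach of the kernel: (a-b)^2 <= 2a^2 + 2b^2, and each
  of the two terms is integrated in the other variable over a ball of volume at most V
  r^\<alpha>.\<close>

lemma bounded_range_energy:
  assumes u: "u \<in> L2 \<nu>" and r: "0 < r"
  shows "(\<integral>\<^sup>+ y. (\<integral>\<^sup>+ x. ennreal (if dist x y < r then (u x - u y)\<^sup>2 else 0) \<partial>\<nu>) \<partial>\<nu>)
    \<le> ennreal (4 * V * r powr \<alpha> * L2_inner \<nu> u u)"
proof -
  note [measurable] = L2_measurable[OF u]
  define g where "g = (\<lambda>x y. ennreal (2 * (u x)\<^sup>2) * indicator (ball x r) y)"
  have [measurable]: "(\<lambda>z. g (fst z) (snd z)) \<in> borel_measurable (\<nu> \<Otimes>\<^sub>M \<nu>)"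
    "(\<lambda>z. g (snd z) (fst z)) \<in> borel_measurable (\<nu> \<Otimes>\<^sub>M \<nu>)"
    unfolding g_def indicator_def mem_ball by measurable
  have inner: "(\<integral>\<^sup>+ x. (\<integral>\<^sup>+ y. g x y \<partial>\<nu>) \<partial>\<nu>) \<le> ennreal (2 * V * r powr \<alpha> * L2_inner \<nu> u u)"
  proof -
    have "(\<integral>\<^sup>+ y. g x y \<partial>\<nu>) \<le> ennreal (2 * V * r powr \<alpha>) * ennreal ((u x)\<^sup>2)" for x
    proof -
      have "(\<integral>\<^sup>+ y. g x y \<partial>\<nu>) = ennreal (2 * (u x)\<^sup>2) * emeasure \<nu> (ball x r)"
        unfolding g_def using sets_eq by (simp add: nn_integral_cmult_indicator)
      also have "\<dots> \<le> ennreal (2 * (u x)\<^sup>2) * ennreal (V * r powr \<alpha>)"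
        using ball_upper[OF r] by (intro mult_left_mono) auto
      also have "\<dots> = ennreal (2 * V * r powr \<alpha>) * ennreal ((u x)\<^sup>2)"
        using pos by (simp add: ennreal_mult'[symmetric] mult_ac)
      finally show ?thesis .
    qed
    then have "(\<integral>\<^sup>+ x. (\<integral>\<^sup>+ y. g x y \<partial>\<nu>) \<partial>\<nu>) \<le> (\<integral>\<^sup>+ x. ennreal (2 * V * r powr \<alpha>) * ennreal ((u x)\<^sup>2) \<partial>\<nu>)"
      by (intro nn_integral_mono)
    also have "\<dots> = ennreal (2 * V * r powr \<alpha>) * ennreal (L2_inner \<nu> u u)"
      by (simp add: nn_integral_cmult nn_integral_L2 u)
    finally show ?thesis using pos by (simp add: ennreal_mult'[symmetric])
  qed
  have swap: "(\<integral>\<^sup>+ y. (\<integral>\<^sup>+ x. g x y \<partial>\<nu>) \<partial>\<nu>) = (\<integral>\<^sup>+ x. (\<integral>\<^sup>+ y. g x y \<partial>\<nu>) \<partial>\<nu>)"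
    by (rule Fubini') (simp add: case_prod_beta')
  have "(\<integral>\<^sup>+ y. (\<integral>\<^sup>+ x. ennreal (if dist x y < r then (u x - u y)\<^sup>2 else 0) \<partial>\<nu>) \<partial>\<nu>)
    \<le> (\<integral>\<^sup>+ y. (\<integral>\<^sup>+ x. g x y + g y x \<partial>\<nu>) \<partial>\<nu>)"
  proof (intro nn_integral_mono)
    fix x y
    have "(u x - u y)\<^sup>2 \<le> 2 * (u x)\<^sup>2 + 2 * (u y)\<^sup>2"
      using sum_squares_bound[of "u x" "- u y"] by (simp add: power2_diff)
    then show "ennreal (if dist x y < r then (u x - u y)\<^sup>2 else 0) \<le> g x y + g y x"
      by (simp add: g_def dist_commute ennreal_plus[symmetric] ennreal_leI del: ennreal_plus)
  qed
  also have "\<dots> = (\<integral>\<^sup>+ y. (\<integral>\<^sup>+ x. g x y \<partial>\<nu>) \<partial>\<nu>) + (\<integral>\<^sup>+ y. (\<integral>\<^sup>+ x. g y x \<partial>\<nu>) \<partial>\<nu>)"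
  proof -
    have [measurable]: "(\<lambda>x. g x y) \<in> borel_measurable \<nu>" "g y \<in> borel_measurable \<nu>" for y
      unfolding g_def indicator_def mem_ball by measurable
    show ?thesis
      by (subst nn_integral_add[symmetric])
        (auto intro!: nn_integral_cong nn_integral_add sigma_finite_measure.borel_measurable_nn_integral[OF sigma_finite_nu] simp: case_prod_beta')
  qed
  also have "\<dots> \<le> ennreal (2 * V * r powr \<alpha> * L2_inner \<nu> u u) + ennreal (2 * V * r powr \<alpha> * L2_inner \<nu> u u)"
    unfolding swap by (intro add_mono inner)
  also have "\<dots> = ennreal (4 * V * r powr \<alpha> * L2_inner \<nu> u u)"
    using pos L2_inner_nonneg[of \<nu> u] by (subst ennreal_plus[symmetric]) auto
  finally show ?thesis .
qed

end

section \<open>Singular double integrals over dyadic scales\<close>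

lemma dyadic_powr:
  fixes r a :: real
  assumes "r > 0"
  shows "(r * 2 ^ j) powr a = r powr a * (2 powr a) ^ j"
    and "(r / 2 ^ j) powr a = r powr a * (2 powr (- a)) ^ j"
proof -
  have 2: "(2 ^ j :: real) powr b = (2 powr b) ^ j" for b :: real
    by (simp add: powr_realpow[symmetric] powr_powr mult.commute)
  show "(r * 2 ^ j) powr a = r powr a * (2 powr a) ^ j"
    using assms by (simp add: powr_mult 2)
  show "(r / 2 ^ j) powr a = r powr a * (2 powr (- a)) ^ j"
  proof -
    have "(r / 2 ^ j) powr a = r powr a / (2 powr a) ^ j"
      using assms by (simp add: powr_divide 2)
    then show ?thesis by (simp add: powr_minus power_inverse divide_inverse)
  qed
qed

context heat_kernel_estimates
begin

text \<open>K depends on neither u nor r0 nor L, because the bound is later applied to infinitely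
  many functions, each with its own scale.\<close>

lemma singular_energy_bound:
  assumes \<beta>: "0 < \<beta>" "\<beta> < \<beta>0"
  obtains K where "K > 0" and
    "\<And>u r0 L. \<lbrakk>u \<in> L2 \<nu>; 0 < r0; r0 < R; 0 \<le> L;
        \<And>r. 0 < r \<Longrightarrow> r \<le> r0 \<Longrightarrow> defect (r powr \<beta>0) u \<le> L * r powr \<beta>0\<rbrakk> \<Longrightarrow>
      (\<integral>\<^sup>+ y. (\<integral>\<^sup>+ x. ennreal ((u x - u y)\<^sup>2 / dist x y powr (\<alpha> + \<beta>)) \<partial>\<nu>) \<partial>\<nu>)
        \<le> ennreal (K * (L * r0 powr (\<beta>0 - \<beta>) + L2_inner \<nu> u u * r0 powr (- \<beta>)))"
proof -
  \<comment> \<open>Ratios of the two geometric series. At a scale s below r0 the weight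
    s^(-\<alpha>-\<beta>) meets an energy of order s^(\<alpha>+\<beta>0); above r0 it meets one of
    order s^\<alpha>. The series converge by \<beta> < \<beta>0 and by \<beta> > 0
    respectively.\<close>
  define q1 where "q1 = (2::real) powr (- (\<beta>0 - \<beta>))"
  define q2 where "q2 = (2::real) powr (- \<beta>)"
  have "q1 < 2 powr 0" "q2 < 2 powr 0"
    unfolding q1_def q2_def using \<beta> by (intro powr_less_mono; simp)+
  then have q: "0 < q1" "q1 < 1" "0 < q2" "q2 < 1" by (auto simp: q1_def q2_def)
  define K1 where "K1 = 2 / c * 2 powr (\<alpha> + \<beta>)"
  define K2 where "K2 = 4 * V * 2 powr \<alpha>"
  have K12: "K1 > 0" "K2 > 0" using pos by (auto simp: K1_def K2_def)
  define K where "K = K1 / (1 - q1) + K2 / (1 - q2)"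
  have Kpos: "K > 0" unfolding K_def using K12 q by (intro add_pos_pos) auto
  have bound: "(\<integral>\<^sup>+ y. (\<integral>\<^sup>+ x. ennreal ((u x - u y)\<^sup>2 / dist x y powr (\<alpha> + \<beta>)) \<partial>\<nu>) \<partial>\<nu>)
        \<le> ennreal (K * (L * r0 powr (\<beta>0 - \<beta>) + L2_inner \<nu> u u * r0 powr (- \<beta>)))"
    if u: "u \<in> L2 \<nu>" and r0: "0 < r0" "r0 < R" and L: "0 \<le> L"
      and def: "\<And>r. 0 < r \<Longrightarrow> r \<le> r0 \<Longrightarrow> defect (r powr \<beta>0) u \<le> L * r powr \<beta>0"
    for u r0 L
  proof -
    let ?P = "\<nu> \<Otimes>\<^sub>M \<nu>"
    note [measurable] = L2_measurable[OF u]
    define N where "N = L2_inner \<nu> u u"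
    have N: "N \<ge> 0" by (simp add: N_def L2_inner_nonneg)
    \<comment> \<open>Full neighbourhoods replace the annuli: on an annulus the weight is at most
      its value at the inner radius, hence r0/2^(j+1) in a and r0 2^j in b, and the annulus itself
      is enlarged to everything within the outer radius.\<close>
    define near where "near j x y = ennreal (if dist x y \<le> r0 / 2 ^ j then (u x - u y)\<^sup>2 else 0)"
      for j :: nat and x y
    define far where "far j x y = ennreal (if dist x y < r0 * 2 ^ Suc j then (u x - u y)\<^sup>2 else 0)"
      for j :: nat and x y
    define a where "a j = ennreal ((r0 / 2 ^ Suc j) powr (- (\<alpha> + \<beta>)))" for j :: nat
    define b where "b j = ennreal ((r0 * 2 ^ j) powr (- (\<alpha> + \<beta>)))" for j :: nat
    have [measurable]: "(\<lambda>z. near j (fst z) (snd z)) \<in> borel_measurable ?P"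
      "(\<lambda>z. far j (fst z) (snd z)) \<in> borel_measurable ?P" for j
      unfolding near_def far_def by measurable
    have pointwise: "ennreal ((u x - u y)\<^sup>2 / dist x y powr (\<alpha> + \<beta>))
      \<le> (\<Sum>j. a j * near j x y) + (\<Sum>j. b j * far j x y)" for x y
    proof -
      have term_le: "f j \<le> (\<Sum>j. f j)" for f :: "nat \<Rightarrow> ennreal" and j
        using sum_le_suminf[of f "{j}"] by simp
      have decr: "(u x - u y)\<^sup>2 / dist x y powr (\<alpha> + \<beta>) \<le> s powr (- (\<alpha> + \<beta>)) * (u x - u y)\<^sup>2"
        if "0 < s" "s \<le> dist x y" for s
      proof -
        have "dist x y powr (- (\<alpha> + \<beta>)) \<le> s powr (- (\<alpha> + \<beta>))"
          using that pos \<beta> by (intro powr_mono2') auto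
        then have "dist x y powr (- (\<alpha> + \<beta>)) * (u x - u y)\<^sup>2 \<le> s powr (- (\<alpha> + \<beta>)) * (u x - u y)\<^sup>2"
          by (intro mult_right_mono) auto
        then show ?thesis by (simp only: powr_minus) (simp add: divide_inverse mult.commute)
      qed
      consider "dist x y = 0" | "0 < dist x y" "dist x y \<le> r0" | "r0 < dist x y"
        using zero_le_dist[of x y] by linarith
      then show ?thesis
      proof cases
        case 1
        then show ?thesis by simp
      next
        case 2
        then have "1 \<le> r0 / dist x y" by simp
        then obtain j where j: "2 ^ j \<le> r0 / dist x y" "r0 / dist x y < 2 ^ Suc j"
          by (rule ex_dyadic_scale)
        have d: "dist x y \<le> r0 / 2 ^ j" "r0 / 2 ^ Suc j \<le> dist x y"
          using j 2 by (auto simp: field_simps)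
        have "ennreal ((u x - u y)\<^sup>2 / dist x y powr (\<alpha> + \<beta>))
            \<le> ennreal ((r0 / 2 ^ Suc j) powr (- (\<alpha> + \<beta>)) * (u x - u y)\<^sup>2)"
          using r0 by (intro ennreal_leI decr d(2)) simp
        also have "\<dots> = a j * near j x y"
          using d(1) by (simp add: a_def near_def ennreal_mult)
        also have "\<dots> \<le> (\<Sum>j. a j * near j x y)" by (rule term_le)
        finally show ?thesis by (rule add_increasing2[rotated]) simp
      next
        case 3
        then have "1 \<le> dist x y / r0" using r0 by simp
        then obtain j where j: "2 ^ j \<le> dist x y / r0" "dist x y / r0 < 2 ^ Suc j"
          by (rule ex_dyadic_scale)
        have d: "dist x y < r0 * 2 ^ Suc j" "r0 * 2 ^ j \<le> dist x y"
          using j r0 by (auto simp: field_simps)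
        have "ennreal ((u x - u y)\<^sup>2 / dist x y powr (\<alpha> + \<beta>))
            \<le> ennreal ((r0 * 2 ^ j) powr (- (\<alpha> + \<beta>)) * (u x - u y)\<^sup>2)"
          using r0 by (intro ennreal_leI decr d(2)) simp
        also have "\<dots> = b j * far j x y"
          using d(1) by (simp add: b_def far_def ennreal_mult)
        also have "\<dots> \<le> (\<Sum>j. b j * far j x y)" by (rule term_le)
        finally show ?thesis by (rule add_increasing[rotated]) simp
      qed
    qed
    have near_le: "a j * (\<integral>\<^sup>+ z. near j (fst z) (snd z) \<partial>?P)
        \<le> ennreal (K1 * L * r0 powr (\<beta>0 - \<beta>) * q1 ^ j)" for j
    proof -
      define s where "s = r0 / 2 ^ j"
      have "1 * r0 \<le> 2 ^ j * r0" using r0 by (intro mult_right_mono) auto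
      then have "0 < s" "s \<le> r0" using r0 by (auto simp: s_def field_simps)
      then have s: "0 < s" "s \<le> r0" "s < R" using r0 by auto
      have "(\<integral>\<^sup>+ z. near j (fst z) (snd z) \<partial>?P) = (\<integral>\<^sup>+ y. (\<integral>\<^sup>+ x. near j x y \<partial>\<nu>) \<partial>\<nu>)"
        by (subst nn_integral_snd[symmetric]) auto
      also have "\<dots> \<le> ennreal (2 / c * s powr \<alpha> * defect (s powr \<beta>0) u)"
        unfolding near_def s_def[symmetric] by (rule near_diagonal_energy[OF u s(1,3)])
      also have "\<dots> \<le> ennreal (2 / c * s powr \<alpha> * (L * s powr \<beta>0))"
        using def[OF s(1,2)] pos by (intro ennreal_leI mult_left_mono) auto
      finally have "a j * (\<integral>\<^sup>+ z. near j (fst z) (snd z) \<partial>?P)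
          \<le> a j * ennreal (2 / c * s powr \<alpha> * (L * s powr \<beta>0))"
        by (intro mult_left_mono) auto
      also have "\<dots> = ennreal ((s / 2) powr (- (\<alpha> + \<beta>)) * (2 / c * s powr \<alpha> * (L * s powr \<beta>0)))"
        unfolding a_def using L pos by (subst ennreal_mult'[symmetric]) (auto simp: s_def mult.commute)
      also have "(s / 2) powr (- (\<alpha> + \<beta>)) = 2 powr (\<alpha> + \<beta>) * s powr (- (\<alpha> + \<beta>))"
        using dyadic_powr(2)[OF s(1), of 1 "- (\<alpha> + \<beta>)"]
        by (simp only: power_one_right minus_minus mult.commute)
      also have "2 powr (\<alpha> + \<beta>) * s powr (- (\<alpha> + \<beta>)) * (2 / c * s powr \<alpha> * (L * s powr \<beta>0))
        = K1 * L * (s powr (- (\<alpha> + \<beta>)) * s powr \<alpha> * s powr \<beta>0)"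
        by (simp add: K1_def mult_ac)
      also have "s powr (- (\<alpha> + \<beta>)) * s powr \<alpha> * s powr \<beta>0 = s powr (\<beta>0 - \<beta>)"
        by (simp add: powr_add[symmetric])
      also have "\<dots> = r0 powr (\<beta>0 - \<beta>) * q1 ^ j"
        unfolding s_def q1_def by (rule dyadic_powr(2)[OF r0(1)])
      finally show ?thesis by (simp add: mult_ac)
    qed
    have far_le: "b j * (\<integral>\<^sup>+ z. far j (fst z) (snd z) \<partial>?P)
        \<le> ennreal (K2 * N * r0 powr (- \<beta>) * q2 ^ j)" for j
    proof -
      define s where "s = r0 * 2 ^ j"
      have s: "0 < s" using r0 by (auto simp: s_def)
      have s2: "r0 * 2 ^ Suc j = s * 2" by (simp add: s_def)
      have "(\<integral>\<^sup>+ z. far j (fst z) (snd z) \<partial>?P) = (\<integral>\<^sup>+ y. (\<integral>\<^sup>+ x. far j x y \<partial>\<nu>) \<partial>\<nu>)"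
        by (subst nn_integral_snd[symmetric]) auto
      also have "\<dots> \<le> ennreal (4 * V * (s * 2) powr \<alpha> * N)"
        unfolding far_def s2 N_def by (rule bounded_range_energy[OF u]) (use s in auto)
      finally have "b j * (\<integral>\<^sup>+ z. far j (fst z) (snd z) \<partial>?P)
          \<le> b j * ennreal (4 * V * (s * 2) powr \<alpha> * N)"
        by (intro mult_left_mono) auto
      also have "\<dots> = ennreal (s powr (- (\<alpha> + \<beta>)) * (4 * V * (s * 2) powr \<alpha> * N))"
        unfolding b_def s_def[symmetric] using N pos by (subst ennreal_mult'[symmetric]) auto
      also have "(s * 2) powr \<alpha> = s powr \<alpha> * 2 powr \<alpha>"
        using s by (simp add: powr_mult)
      also have "s powr (- (\<alpha> + \<beta>)) * (4 * V * (s powr \<alpha> * 2 powr \<alpha>) * N)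
        = K2 * N * (s powr (- (\<alpha> + \<beta>)) * s powr \<alpha>)"
        by (simp add: K2_def mult_ac)
      also have "s powr (- (\<alpha> + \<beta>)) * s powr \<alpha> = s powr (- \<beta>)"
        by (simp add: powr_add[symmetric])
      also have "\<dots> = r0 powr (- \<beta>) * q2 ^ j"
        unfolding s_def q2_def by (rule dyadic_powr(1)[OF r0(1)])
      finally show ?thesis by (simp add: mult_ac)
    qed
    define X where "X = L * r0 powr (\<beta>0 - \<beta>)"
    define Y where "Y = N * r0 powr (- \<beta>)"
    have XY: "0 \<le> X" "0 \<le> Y" using L N by (auto simp: X_def Y_def)
    have "(\<integral>\<^sup>+ y. (\<integral>\<^sup>+ x. ennreal ((u x - u y)\<^sup>2 / dist x y powr (\<alpha> + \<beta>)) \<partial>\<nu>) \<partial>\<nu>)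
      \<le> (\<integral>\<^sup>+ y. (\<integral>\<^sup>+ x. (\<Sum>j. a j * near j x y) + (\<Sum>j. b j * far j x y) \<partial>\<nu>) \<partial>\<nu>)"
      by (intro nn_integral_mono pointwise)
    also have "\<dots> = (\<integral>\<^sup>+ z. (\<Sum>j. a j * near j (fst z) (snd z)) + (\<Sum>j. b j * far j (fst z) (snd z)) \<partial>?P)"
      by (subst nn_integral_snd[symmetric]) auto
    also have "\<dots> = (\<Sum>j. a j * (\<integral>\<^sup>+ z. near j (fst z) (snd z) \<partial>?P))
        + (\<Sum>j. b j * (\<integral>\<^sup>+ z. far j (fst z) (snd z) \<partial>?P))"
      by (simp add: nn_integral_add nn_integral_suminf nn_integral_cmult)
    also have "\<dots> \<le> (\<Sum>j. ennreal (K1 * X * q1 ^ j)) + (\<Sum>j. ennreal (K2 * Y * q2 ^ j))"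
      using near_le far_le by (intro add_mono suminf_le) (auto simp: X_def Y_def mult.assoc)
    also have "\<dots> = ennreal (K1 * X / (1 - q1)) + ennreal (K2 * Y / (1 - q2))"
      using XY K12 q by (intro arg_cong2[where f = "(+)"] suminf_ennreal_geometric) auto
    also have "\<dots> = ennreal (K1 * X / (1 - q1) + K2 * Y / (1 - q2))"
      using XY K12 q by (subst ennreal_plus) auto
    also have "\<dots> \<le> ennreal (K * (X + Y))"
    proof (rule ennreal_leI)
      have "0 \<le> K1 / (1 - q1) * Y" "0 \<le> K2 / (1 - q2) * X" using XY K12 q by auto
      then show "K1 * X / (1 - q1) + K2 * Y / (1 - q2) \<le> K * (X + Y)"
        by (simp add: K_def algebra_simps add_divide_distrib)
    qed
    finally show ?thesis by (simp add: X_def Y_def N_def)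
  qed
  show thesis using that[OF Kpos] bound by blast
qed

section \<open>Test functions at a single time scale\<close>

text \<open>For f supported in S, (T_t f,f) involves the kernel on S x S only, so kernel bounds
  there bound (T_t f,f) after multiplication by b^2 and the squared measure of S.\<close>

lemma T_indicator_inner:
  assumes S: "S \<in> sets \<nu>" "emeasure \<nu> S < \<infinity>" and t: "t > 0"
    and f: "f = (\<lambda>x. b * indicator S x)" "b \<ge> 0"
  shows "f \<in> L2 \<nu>" "L2_inner \<nu> f f = b\<^sup>2 * measure \<nu> S"
    and "(\<And>x y. x \<in> S \<Longrightarrow> y \<in> S \<Longrightarrow> p t x y \<le> P) \<Longrightarrow>
      L2_inner \<nu> (T t f) f \<le> P * b\<^sup>2 * (measure \<nu> S)\<^sup>2"
    and "(\<And>x y. x \<in> S \<Longrightarrow> y \<in> S \<Longrightarrow> P \<le> p t x y) \<Longrightarrow>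
      P * b\<^sup>2 * (measure \<nu> S)\<^sup>2 \<le> L2_inner \<nu> (T t f) f"
proof -
  define W where "W = measure \<nu> S"
  have sq: "(f x)\<^sup>2 = b\<^sup>2 * indicator S x" for x
    by (simp add: f indicator_def)
  have int: "integrable \<nu> (\<lambda>x. C * indicator S x)" for C :: real
    using S by (intro integrable_mult_right integrable_real_indicator)
  have val: "(\<integral>x. C * indicator S x \<partial>\<nu>) = C * W" for C :: real
    using S by (simp add: W_def)
  show fL: "f \<in> L2 \<nu>"
    using S int[of "b\<^sup>2"] unfolding L2_def mem_Collect_eq sq by (auto simp: f(1))
  show "L2_inner \<nu> f f = b\<^sup>2 * measure \<nu> S"
    unfolding L2_inner_def using sq val[of "b\<^sup>2"] by (simp add: power2_eq_square W_def)
  have f0: "0 \<le> f x" for x using f by simp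
  have Tint: "integrable \<nu> (\<lambda>x. T t f x * f x)"
    by (intro L2_mult_integrable T_L2 t fL)
  have val2: "(\<integral>x. P * b * W * f x \<partial>\<nu>) = P * b\<^sup>2 * W\<^sup>2" for P
    using val[of "P * b * W * b"] by (simp add: f power2_eq_square mult_ac)
  have int2: "integrable \<nu> (\<lambda>x. P * b * W * f x)" for P
    using int[of "P * b * W * b"] by (simp add: f mult_ac)
  show "L2_inner \<nu> (T t f) f \<le> P * b\<^sup>2 * (measure \<nu> S)\<^sup>2"
    if P: "\<And>x y. x \<in> S \<Longrightarrow> y \<in> S \<Longrightarrow> p t x y \<le> P"
    unfolding L2_inner_def W_def[symmetric] val2[symmetric]
  proof (rule integral_mono_AE[OF Tint int2])
    show "AE x in \<nu>. T t f x * f x \<le> P * b * W * f x"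
      using kernel_AE[OF t fL]
    proof eventually_elim
      case (elim x)
      show ?case
      proof (cases "x \<in> S")
        case True
        have "T t f x = (\<integral>y. p t x y * f y \<partial>\<nu>)" using elim by simp
        also have "\<dots> \<le> (\<integral>y. P * b * indicator S y \<partial>\<nu>)"
          using elim int f P[OF True]
          by (intro integral_mono) (auto simp: indicator_def intro!: mult_right_mono)
        finally have "T t f x \<le> P * b * W" unfolding val .
        then show ?thesis by (rule mult_right_mono) (rule f0)
      qed (simp add: f)
    qed
  qed
  show "P * b\<^sup>2 * (measure \<nu> S)\<^sup>2 \<le> L2_inner \<nu> (T t f) f"
    if P: "\<And>x y. x \<in> S \<Longrightarrow> y \<in> S \<Longrightarrow> P \<le> p t x y"
    unfolding L2_inner_def W_def[symmetric] val2[symmetric]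
  proof (rule integral_mono_AE[OF int2 Tint])
    show "AE x in \<nu>. P * b * W * f x \<le> T t f x * f x"
      using kernel_AE[OF t fL]
    proof eventually_elim
      case (elim x)
      show ?case
      proof (cases "x \<in> S")
        case True
        have "(\<integral>y. P * b * indicator S y \<partial>\<nu>) \<le> (\<integral>y. p t x y * f y \<partial>\<nu>)"
          using elim int f P[OF True]
          by (intro integral_mono) (auto simp: indicator_def intro!: mult_right_mono)
        also have "\<dots> = T t f x" using elim by simp
        finally have "P * b * W \<le> T t f x" unfolding val .
        then show ?thesis by (rule mult_right_mono) (rule f0)
      qed (simp add: f)
    qed
  qed
qed

text \<open>The function is \<open>T\<^sub>s f\<close> with \<open>f\<close> the normalised indicator of a ball of radius \<open>\<tau>\<^bsup>1/\<beta>0\<^esup>\<close>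
  and \<open>s\<close> comparable to \<open>\<tau>\<close>: the kernel bounds force \<open>(T\<^sub>t f, f)\<close> to drop by a fixed amount
  between two times comparable to \<open>\<tau>\<close>.\<close>

lemma bump_exists:
  obtains A \<kappa> B \<rho> where "A > 0" "\<kappa> > 0" "B > 0" "\<rho> > 0"
    "\<And>\<tau>. 0 < \<tau> \<Longrightarrow> \<tau> < \<rho> \<Longrightarrow> \<exists>v\<in>L2 \<nu>. L2_inner \<nu> v v \<le> 1 \<and> \<kappa> \<le> defect (A * \<tau>) v \<and>
      (\<forall>t>0. defect t v \<le> B * t / \<tau>)"
proof -
  \<comment> \<open>2 \<kappa> is the lower bound for (T_t f,f) at t = (2r)^\<beta>0: points of a
    ball of radius r are at distance at most 2r, and the volume bound contributes 1/V.\<close>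
  define \<kappa> where "\<kappa> = c * 2 powr (- \<alpha>) / V / 2"
  have \<kappa>: "\<kappa> > 0" using pos by (simp add: \<kappa>_def)
  \<comment> \<open>At time (N r)^\<beta>0 the upper kernel bound gives (T_t f,f) <= M V
    N^(-\<alpha>), which this N makes at most \<kappa>. The 3 ensures N > 2 and thus A > 0.\<close>
  define N where "N = max 3 ((M * V / \<kappa>) powr (1 / \<alpha>))"
  have N3: "N \<ge> 3" by (simp add: N_def)
  have "M * V / \<kappa> = ((M * V / \<kappa>) powr (1 / \<alpha>)) powr \<alpha>"
    using pos \<kappa> by (simp add: powr_powr)
  also have "\<dots> \<le> N powr \<alpha>"
    using pos by (intro powr_mono2) (auto simp: N_def)
  finally have N: "M * V * N powr (- \<alpha>) \<le> \<kappa>"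
    using \<kappa> N3 by (simp add: powr_minus field_simps)
  \<comment> \<open>For r^\<beta>0 = \<tau>, A \<tau> is the gap between the times (2r)^\<beta>0 and
    (N r)^\<beta>0, B/\<tau> is the reciprocal of the smoothing time (2r)^\<beta>0 / 2, and \<tau> <
    \<rho> means N r < R.\<close>
  define A where "A = N powr \<beta>0 - 2 powr \<beta>0"
  have A: "A > 0" using N3 pos by (auto simp: A_def intro!: powr_less_mono2)
  define B where "B = 2 / 2 powr \<beta>0"
  have B: "B > 0" by (simp add: B_def)
  define \<rho> where "\<rho> = (R / N) powr \<beta>0"
  have \<rho>: "\<rho> > 0" using pos N3 by (simp add: \<rho>_def)
  have main: "\<exists>v\<in>L2 \<nu>. L2_inner \<nu> v v \<le> 1 \<and> \<kappa> \<le> defect (A * \<tau>) v \<and> (\<forall>t>0. defect t v \<le> B * t / \<tau>)"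
    if \<tau>: "0 < \<tau>" "\<tau> < \<rho>" for \<tau>
  proof -
    define r where "r = \<tau> powr (1 / \<beta>0)"
    have r: "r > 0" using \<tau> by (simp add: r_def)
    have r\<tau>: "r powr \<beta>0 = \<tau>" using \<tau> pos by (simp add: r_def powr_powr)
    have "r < \<rho> powr (1 / \<beta>0)" unfolding r_def using \<tau> pos by (intro powr_less_mono2) auto
    also have "\<dots> = R / N" using pos N3 by (simp add: \<rho>_def powr_powr)
    finally have NrR: "N * r < R" using N3 by (simp add: field_simps)
    have "2 * r \<le> N * r" "1 * r \<le> N * r" using N3 r by (auto intro!: mult_right_mono)
    with NrR have rR: "2 * r < R" "r < R" by auto
    define x0 :: 'a where "x0 = undefined"
    define S where "S = ball x0 r"
    have S: "S \<in> sets \<nu>" by (simp add: S_def sets_eq)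
    have S_up: "emeasure \<nu> S \<le> ennreal (V * r powr \<alpha>)"
      and S_lo: "ennreal (r powr \<alpha> / V) \<le> emeasure \<nu> S"
      unfolding S_def using ball_upper[OF r] ball_lower[OF r rR(2)] by auto
    have S_fin: "emeasure \<nu> S < \<infinity>" using S_up by (simp add: le_less_trans)
    define W where "W = measure \<nu> S"
    have eW: "emeasure \<nu> S = ennreal W"
      using S_fin by (simp add: W_def emeasure_eq_ennreal_measure)
    have W_up: "W \<le> V * r powr \<alpha>"
      using S_up pos unfolding eW by (subst (asm) ennreal_le_iff) auto
    have W_lo: "r powr \<alpha> / V \<le> W"
      using S_lo unfolding eW by (subst (asm) ennreal_le_iff) (auto simp: W_def)
    have "0 < r powr \<alpha> / V" using r pos by simp
    with W_lo have W: "W > 0" by linarith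
    define b where "b = 1 / sqrt W"
    define f where "f = (\<lambda>x. b * indicator S x :: real)"
    have b: "b \<ge> 0" "b\<^sup>2 = 1 / W" using W by (auto simp: b_def power_divide)
    note ind = T_indicator_inner[OF S S_fin _ f_def b(1), folded W_def, unfolded b(2)]
    have f: "f \<in> L2 \<nu>" "L2_inner \<nu> f f = 1" using ind(1,2)[of 1] W by auto
    have WW: "P * (1 / W) * W\<^sup>2 = P * W" for P using W by (simp add: power2_eq_square)
    have k_lo: "2 * \<kappa> \<le> L2_inner \<nu> (T ((2 * r) powr \<beta>0) f) f"
    proof -
      have "2 * \<kappa> = c * (2 * r) powr (- \<alpha>) * (r powr \<alpha> / V)"
        using r by (simp add: \<kappa>_def powr_mult powr_minus)
      also have "\<dots> \<le> c * (2 * r) powr (- \<alpha>) * W"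
        using W_lo pos by (intro mult_left_mono) auto
      also have "\<dots> \<le> L2_inner \<nu> (T ((2 * r) powr \<beta>0) f) f"
        unfolding WW[symmetric]
      proof (rule ind(4))
        fix x y assume "x \<in> S" "y \<in> S"
        then have "dist x y \<le> 2 * r"
          using dist_triangle3[of x y x0] by (simp add: S_def)
        then show "c * (2 * r) powr (- \<alpha>) \<le> p ((2 * r) powr \<beta>0) x y"
          using r rR by (intro kernel_lower) auto
      qed (use r in auto)
      finally show ?thesis .
    qed
    have k_up: "L2_inner \<nu> (T ((N * r) powr \<beta>0) f) f \<le> \<kappa>"
    proof -
      have "L2_inner \<nu> (T ((N * r) powr \<beta>0) f) f \<le> M * (N * r) powr (- \<alpha>) * W"
        unfolding WW[symmetric]
        by (rule ind(3)) (use r N3 NrR in \<open>auto intro!: kernel_upper\<close>)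
      also have "\<dots> \<le> M * (N * r) powr (- \<alpha>) * (V * r powr \<alpha>)"
        using W_up pos by (intro mult_left_mono) auto
      also have "\<dots> = M * V * N powr (- \<alpha>)"
        using r N3 by (simp add: powr_mult powr_minus)
      finally show ?thesis using N by linarith
    qed
    \<comment> \<open>Half of (2r)^\<beta>0, because \<open>defect_T\<close> compares the times 2s
      and 2s + t.\<close>
    define s where "s = (2 * r) powr \<beta>0 / 2"
    have s: "s > 0" using r by (simp add: s_def)
    have s\<tau>: "2 * s = 2 powr \<beta>0 * \<tau>" using r by (simp add: s_def powr_mult r\<tau>)
    have tN: "2 * s + A * \<tau> = (N * r) powr \<beta>0"
      unfolding s\<tau> using r N3 by (simp add: A_def powr_mult r\<tau> algebra_simps)
    show ?thesis
    proof (intro bexI[of _ "T s f"] conjI allI impI)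
      show "T s f \<in> L2 \<nu>" by (intro T_L2 s f)
      show "L2_inner \<nu> (T s f) (T s f) \<le> 1" using T_contraction[OF s f(1)] f(2) by simp
      have "defect (A * \<tau>) (T s f)
        = L2_inner \<nu> (T ((2 * r) powr \<beta>0) f) f - L2_inner \<nu> (T ((N * r) powr \<beta>0) f) f"
        using defect_T[OF s _ f(1), of "A * \<tau>"] A \<tau> unfolding tN by (simp add: s_def)
      with k_lo k_up show "\<kappa> \<le> defect (A * \<tau>) (T s f)" by linarith
      fix t :: real assume t: "t > 0"
      have "defect t (T s f) \<le> t / s"
        using defect_smoothed_le[OF s t f(1)] f(2) by simp
      also have "t / s = 2 * t / (2 * s)" by simp
      also have "\<dots> = B * t / \<tau>" unfolding s\<tau> by (simp add: B_def)
      finally show "defect t (T s f) \<le> B * t / \<tau>" .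
    qed
  qed
  show thesis using that[OF A \<kappa> B \<rho>] main by blast
qed

end

subsection \<open>A lacunary series\<close>

text \<open>Cauchy-Schwarz for the products of sqrt(w_k) and b_k / sqrt(w_k), with extended values
  so that it can be integrated before anything is known to converge.\<close>

lemma suminf_weighted_Cauchy_Schwarz:
  fixes b w :: "nat \<Rightarrow> real"
  assumes w: "\<And>k. w k > 0" "summable w"
  shows "ennreal ((suminf b)\<^sup>2) \<le> ennreal (suminf w) * (\<Sum>k. ennreal ((b k)\<^sup>2 / w k))"
    and "(\<Sum>k. ennreal ((b k)\<^sup>2 / w k)) < \<infinity> \<Longrightarrow> summable b"
proof -
  have wpos: "suminf w > 0" using w by (intro suminf_pos)
  have sum2: "summable (\<lambda>k. (b k)\<^sup>2 / w k)" if "(\<Sum>k. ennreal ((b k)\<^sup>2 / w k)) < \<infinity>"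
    using that w by (intro summable_suminf_not_top) (auto simp: less_imp_le)
  have absle: "\<bar>b k\<bar> \<le> w k + (b k)\<^sup>2 / w k" for k
  proof -
    have "2 * \<bar>b k\<bar> * w k \<le> (b k)\<^sup>2 + (w k)\<^sup>2"
      using sum_squares_bound[of "\<bar>b k\<bar>" "w k"] by simp
    moreover have "0 \<le> \<bar>b k\<bar> * w k" using w(1)[of k] by simp
    ultimately have "\<bar>b k\<bar> * w k \<le> (b k)\<^sup>2 + (w k)\<^sup>2" by linarith
    also have "\<dots> = (w k + (b k)\<^sup>2 / w k) * w k"
      using w(1)[of k] by (simp add: field_simps power2_eq_square)
    finally show ?thesis using w(1)[of k] by simp
  qed
  show summ: "summable b" if "(\<Sum>k. ennreal ((b k)\<^sup>2 / w k)) < \<infinity>"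
    by (rule summable_comparison_test'[OF summable_add[OF w(2) sum2[OF that]]])
      (use absle in auto)
  show "ennreal ((suminf b)\<^sup>2) \<le> ennreal (suminf w) * (\<Sum>k. ennreal ((b k)\<^sup>2 / w k))"
  proof (cases "(\<Sum>k. ennreal ((b k)\<^sup>2 / w k)) < \<infinity>")
    \<comment> \<open>The right side is infinite. Every b that is not summable falls under this
      case, so the value of \<open>suminf b\<close> does not matter there.\<close>
    case False
    then have "(\<Sum>k. ennreal ((b k)\<^sup>2 / w k)) = top" by (simp add: not_less top_unique)
    then show ?thesis using wpos by (simp add: ennreal_mult_top)
  next
    case True
    have "(sum b {..<n})\<^sup>2 \<le> suminf w * (\<Sum>k. (b k)\<^sup>2 / w k)" for n
    proof -
      have "(sum b {..<n})\<^sup>2 = (\<Sum>k<n. sqrt (w k) * (b k / sqrt (w k)))\<^sup>2"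
        using w(1) by (simp add: less_imp_neq[THEN not_sym])
      also have "\<dots> \<le> (\<Sum>k<n. (sqrt (w k))\<^sup>2) * (\<Sum>k<n. (b k / sqrt (w k))\<^sup>2)"
        by (rule Cauchy_Schwarz_ineq_sum)
      also have "\<dots> = sum w {..<n} * (\<Sum>k<n. (b k)\<^sup>2 / w k)"
        using w(1) by (simp add: power_divide less_imp_le)
      also have "\<dots> \<le> suminf w * (\<Sum>k. (b k)\<^sup>2 / w k)"
        using w sum2[OF True]
        by (intro mult_mono sum_le_suminf) (auto intro!: sum_nonneg suminf_nonneg simp: less_imp_le)
      finally show ?thesis .
    qed
    moreover have "(\<lambda>n. (sum b {..<n})\<^sup>2) \<longlonglongrightarrow> (suminf b)\<^sup>2"
      using summable_LIMSEQ[OF summ[OF True]] by (intro tendsto_intros)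
    ultimately have "(suminf b)\<^sup>2 \<le> suminf w * (\<Sum>k. (b k)\<^sup>2 / w k)"
      by (intro LIMSEQ_le_const2) auto
    then have "ennreal ((suminf b)\<^sup>2) \<le> ennreal (suminf w * (\<Sum>k. (b k)\<^sup>2 / w k))"
      by (rule ennreal_leI)
    also have "\<dots> = ennreal (suminf w) * ennreal (\<Sum>k. (b k)\<^sup>2 / w k)"
      using wpos by (simp add: ennreal_mult')
    also have "ennreal (\<Sum>k. (b k)\<^sup>2 / w k) = (\<Sum>k. ennreal ((b k)\<^sup>2 / w k))"
      using w sum2[OF True] by (intro suminf_ennreal2[symmetric]) (auto simp: less_imp_le)
    finally show ?thesis .
  qed
qed

text \<open>With g = z^(-1/(m+1)) > 1 the product g^m z equals 1/g < 1, and Bernoulli's inequality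
  bounds k + 1 by a multiple of g^k. The series is dominated by a geometric one of ratio
  1/g.\<close>

lemma summable_power_times_geometric:
  fixes z :: real
  assumes "0 < z" "z < 1"
  shows "summable (\<lambda>k. real (Suc k) ^ m * z ^ k)"
proof -
  define g where "g = z powr (- 1 / (real m + 1))"
  have "z powr 0 < g"
    unfolding g_def using assms by (intro powr_less_mono') auto
  then have g: "g > 1" using assms by simp
  have gz: "g ^ m * z < 1"
  proof -
    have "real m + 1 \<noteq> 0" by linarith
    then have "(- 1 / (real m + 1)) * (- (real m + 1)) = 1"
      by (simp only: mult_minus_right) (simp add: nonzero_eq_divide_eq)
    then have "g powr (- (real m + 1)) = z"
      unfolding g_def powr_powr using assms by simp
    then have "g ^ m * z = g ^ m * (g powr (- (real m + 1)))" by simp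
    also have "\<dots> = g powr real m * g powr (- (real m + 1))"
      using g by (simp add: powr_realpow)
    also have "\<dots> = inverse g"
      using g by (simp add: powr_add[symmetric] powr_minus)
    finally show ?thesis using g by (simp add: inverse_less_1_iff)
  qed
  define C where "C = 1 + 1 / (g - 1)"
  have lin: "real (Suc k) \<le> C * g ^ k" for k
  proof -
    have "1 + real k * (g - 1) \<le> (1 + (g - 1)) ^ k"
      using g by (intro Bernoulli_inequality) auto
    then have "real k * (g - 1) \<le> g ^ k" by simp
    then have "real k \<le> 1 / (g - 1) * g ^ k" using g by (simp add: field_simps)
    moreover have "1 \<le> g ^ k" using g by simp
    ultimately show ?thesis by (simp add: C_def algebra_simps)
  qed
  show ?thesis
  proof (rule summable_comparison_test')
    show "summable (\<lambda>k. C ^ m * (g ^ m * z) ^ k)"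
      using gz g assms by (intro summable_mult summable_geometric) auto
    fix k :: nat
    have "real (Suc k) ^ m * z ^ k \<le> (C * g ^ k) ^ m * z ^ k"
      using lin[of k] assms by (intro mult_right_mono power_mono) auto
    also have "\<dots> = C ^ m * (g ^ m * z) ^ k"
      by (simp add: power_mult_distrib power_mult[symmetric] mult.commute)
    finally show "norm (real (Suc k) ^ m * z ^ k) \<le> C ^ m * (g ^ m * z) ^ k"
      using assms by simp
  qed
qed

section \<open>Norm and energy of series of test functions\<close>

context heat_kernel_estimates
begin

lemma L2_intro:
  assumes "u \<in> borel_measurable \<nu>" "(\<integral>\<^sup>+ x. ennreal ((u x)\<^sup>2) \<partial>\<nu>) \<le> ennreal C" "C \<ge> 0"
  shows "u \<in> L2 \<nu>" "L2_inner \<nu> u u \<le> C"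
proof -
  show u: "u \<in> L2 \<nu>"
    using assms unfolding L2_def
    by (auto intro!: integrableI_nonneg simp: le_less_trans[OF assms(2)])
  show "L2_inner \<nu> u u \<le> C"
    using assms(2,3) unfolding nn_integral_L2[OF u] by simp
qed

text \<open>Weighted Cauchy-Schwarz with the coefficients a as weights: the square of the sum is at
  most \<open>suminf a\<close> times the sum of a_k v_k^2, whose integral is at most
  \<open>suminf a\<close>. Finiteness of that integral also gives convergence almost
  everywhere.\<close>

lemma L2_series:
  assumes v: "\<And>k. v k \<in> L2 \<nu>" "\<And>k. L2_inner \<nu> (v k) (v k) \<le> 1"
    and a: "\<And>k. a k > 0" "summable a" and e: "\<And>k. \<bar>e k\<bar> = (1::real)"
  shows "(\<lambda>x. \<Sum>k. e k * a k * v k x) \<in> L2 \<nu>"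
    and "L2_inner \<nu> (\<lambda>x. \<Sum>k. e k * a k * v k x) (\<lambda>x. \<Sum>k. e k * a k * v k x) \<le> (suminf a)\<^sup>2"
    and "AE x in \<nu>. summable (\<lambda>k. e k * a k * v k x)"
proof -
  note [measurable] = L2_measurable[OF v(1)]
  have e2: "(e k)\<^sup>2 = 1" for k using e[of k] by (simp add: abs_square_eq_1)
  have sum_a: "suminf a > 0" using a by (intro suminf_pos)
  define Q where "Q x = (\<Sum>k. ennreal ((e k * a k * v k x)\<^sup>2 / a k))" for x
  have [measurable]: "Q \<in> borel_measurable \<nu>" unfolding Q_def by measurable
  have Q: "(\<integral>\<^sup>+ x. Q x \<partial>\<nu>) \<le> ennreal (suminf a)"
  proof -
    have "(\<integral>\<^sup>+ x. ennreal ((e k * a k * v k x)\<^sup>2 / a k) \<partial>\<nu>) \<le> ennreal (a k)" for k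
    proof -
      have "(e k * a k * v k x)\<^sup>2 / a k = a k * (v k x)\<^sup>2" for x
        using a(1)[of k] e2[of k] by (simp add: power_mult_distrib power2_eq_square)
      then have "(\<integral>\<^sup>+ x. ennreal ((e k * a k * v k x)\<^sup>2 / a k) \<partial>\<nu>)
          = (\<integral>\<^sup>+ x. ennreal (a k) * ennreal ((v k x)\<^sup>2) \<partial>\<nu>)"
        using a(1)[of k] by (simp add: ennreal_mult')
      also have "\<dots> = ennreal (a k) * ennreal (L2_inner \<nu> (v k) (v k))"
        by (simp add: nn_integral_cmult nn_integral_L2 v)
      also have "\<dots> \<le> ennreal (a k) * 1"
        using v(2)[of k] by (intro mult_left_mono) auto
      finally show ?thesis by simp
    qed
    then have "(\<integral>\<^sup>+ x. Q x \<partial>\<nu>) \<le> (\<Sum>k. ennreal (a k))"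
      unfolding Q_def by (subst nn_integral_suminf) (auto intro!: suminf_le)
    also have "\<dots> = ennreal (suminf a)"
      using a by (intro suminf_ennreal2) (auto simp: less_imp_le)
    finally show ?thesis .
  qed
  have "AE x in \<nu>. Q x \<noteq> \<infinity>"
    using Q by (intro nn_integral_PInf_AE) (auto simp: top_unique)
  then show "AE x in \<nu>. summable (\<lambda>k. e k * a k * v k x)"
  proof eventually_elim
    case (elim x)
    then show ?case
      using suminf_weighted_Cauchy_Schwarz(2)[of a "\<lambda>k. e k * a k * v k x"] a
      by (simp add: Q_def less_top)
  qed
  have "(\<integral>\<^sup>+ x. ennreal ((\<Sum>k. e k * a k * v k x)\<^sup>2) \<partial>\<nu>) \<le> (\<integral>\<^sup>+ x. ennreal (suminf a) * Q x \<partial>\<nu>)"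
    unfolding Q_def by (intro nn_integral_mono suminf_weighted_Cauchy_Schwarz(1) a)
  also have "\<dots> = ennreal (suminf a) * (\<integral>\<^sup>+ x. Q x \<partial>\<nu>)"
    by (simp add: nn_integral_cmult)
  also have "\<dots> \<le> ennreal (suminf a) * ennreal (suminf a)"
    by (intro mult_left_mono Q) simp
  also have "\<dots> = ennreal ((suminf a)\<^sup>2)"
    using sum_a by (simp add: ennreal_mult'[symmetric] power2_eq_square)
  finally have le: "(\<integral>\<^sup>+ x. ennreal ((\<Sum>k. e k * a k * v k x)\<^sup>2) \<partial>\<nu>) \<le> ennreal ((suminf a)\<^sup>2)" .
  have meas: "(\<lambda>x. \<Sum>k. e k * a k * v k x) \<in> borel_measurable \<nu>"
    by measurable
  show "(\<lambda>x. \<Sum>k. e k * a k * v k x) \<in> L2 \<nu>"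
    by (rule L2_intro(1)[OF meas le]) simp
  show "L2_inner \<nu> (\<lambda>x. \<Sum>k. e k * a k * v k x) (\<lambda>x. \<Sum>k. e k * a k * v k x) \<le> (suminf a)\<^sup>2"
    by (rule L2_intro(2)[OF meas le]) simp
qed

text \<open>The same inequality for the differences u(x) - u(y), now with free weights: w has to be
  summable without spoiling the summability of the weighted energies.\<close>

lemma singular_energy_series:
  assumes v: "\<And>k. v k \<in> L2 \<nu>"
    and summ: "AE x in \<nu>. summable (\<lambda>k. b k * v k x)"
    and w: "\<And>k. w k > 0" "summable w"
    and energy: "\<And>k. (\<integral>\<^sup>+ y. (\<integral>\<^sup>+ x. ennreal ((v k x - v k y)\<^sup>2 / dist x y powr \<gamma>) \<partial>\<nu>) \<partial>\<nu>)
        \<le> ennreal (G k)"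
    and G: "\<And>k. G k \<ge> 0" "summable (\<lambda>k. (b k)\<^sup>2 / w k * G k)"
    and u: "u = (\<lambda>x. \<Sum>k. b k * v k x)"
  shows "(\<integral>\<^sup>+ y. (\<integral>\<^sup>+ x. ennreal ((u x - u y)\<^sup>2 / dist x y powr \<gamma>) \<partial>\<nu>) \<partial>\<nu>) < \<infinity>"
proof -
  let ?P = "\<nu> \<Otimes>\<^sub>M \<nu>"
  note [measurable] = L2_measurable[OF v]
  have wpos: "suminf w > 0" using w by (intro suminf_pos)
  define H where "H k x y = ennreal ((v k x - v k y)\<^sup>2 / dist x y powr \<gamma>)" for k x y
  have [measurable]: "(\<lambda>z. H k (fst z) (snd z)) \<in> borel_measurable ?P" for k
    unfolding H_def by measurable
  define J where "J x y = ennreal (suminf w) * (\<Sum>k. ennreal ((b k)\<^sup>2 / w k) * H k x y)" for x y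
  have pointwise: "ennreal ((u x - u y)\<^sup>2 / dist x y powr \<gamma>) \<le> J x y"
    if x: "summable (\<lambda>k. b k * v k x)" and y: "summable (\<lambda>k. b k * v k y)" for x y
  proof -
    define D where "D = dist x y powr \<gamma>"
    have D: "D \<ge> 0" by (simp add: D_def)
    have "u x - u y = (\<Sum>k. b k * v k x - b k * v k y)"
      unfolding u by (rule suminf_diff[OF x y])
    then have "ennreal ((u x - u y)\<^sup>2) \<le> ennreal (suminf w) * (\<Sum>k. ennreal ((b k * v k x - b k * v k y)\<^sup>2 / w k))"
      using suminf_weighted_Cauchy_Schwarz(1)[OF w] by simp
    then have "ennreal ((u x - u y)\<^sup>2) * ennreal (1 / D)
        \<le> ennreal (suminf w) * (\<Sum>k. ennreal ((b k * v k x - b k * v k y)\<^sup>2 / w k)) * ennreal (1 / D)"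
      by (rule mult_right_mono) simp
    also have "\<dots> = ennreal (suminf w) * (\<Sum>k. ennreal ((b k * v k x - b k * v k y)\<^sup>2 / w k) * ennreal (1 / D))"
      by (simp add: mult.assoc)
    also have "\<dots> = J x y"
    proof -
      have "ennreal ((b k * v k x - b k * v k y)\<^sup>2 / w k) * ennreal (1 / D)
        = ennreal ((b k)\<^sup>2 / w k) * H k x y" for k
      proof -
        have "(b k * v k x - b k * v k y)\<^sup>2 / w k * (1 / D) = (b k)\<^sup>2 / w k * ((v k x - v k y)\<^sup>2 / D)"
          by (simp add: right_diff_distrib[symmetric] power_mult_distrib)
        then show ?thesis
          unfolding H_def D_def[symmetric] using w(1)[of k] D
          by (subst (1 2) ennreal_mult'[symmetric]) auto
      qed
      then show ?thesis by (simp add: J_def)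
    qed
    finally show ?thesis
      using D by (simp add: D_def ennreal_mult'[symmetric])
  qed
  have "(\<integral>\<^sup>+ y. (\<integral>\<^sup>+ x. ennreal ((u x - u y)\<^sup>2 / dist x y powr \<gamma>) \<partial>\<nu>) \<partial>\<nu>)
    \<le> (\<integral>\<^sup>+ y. (\<integral>\<^sup>+ x. J x y \<partial>\<nu>) \<partial>\<nu>)"
  \<comment> \<open>The pointwise bound holds for x and y outside one null set, which is discarded
    in each variable of the iterated integral separately.\<close>
  proof (rule nn_integral_mono_AE)
    show "AE y in \<nu>. (\<integral>\<^sup>+ x. ennreal ((u x - u y)\<^sup>2 / dist x y powr \<gamma>) \<partial>\<nu>) \<le> (\<integral>\<^sup>+ x. J x y \<partial>\<nu>)"
      using summ
    proof eventually_elim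
      case (elim y)
      show ?case
      proof (rule nn_integral_mono_AE)
        show "AE x in \<nu>. ennreal ((u x - u y)\<^sup>2 / dist x y powr \<gamma>) \<le> J x y"
          using summ by eventually_elim (rule pointwise[OF _ elim])
      qed
    qed
  qed
  also have "\<dots> = (\<integral>\<^sup>+ z. J (fst z) (snd z) \<partial>?P)"
    unfolding J_def by (subst nn_integral_snd[symmetric]) auto
  also have "\<dots> = ennreal (suminf w) * (\<Sum>k. ennreal ((b k)\<^sup>2 / w k) * (\<integral>\<^sup>+ z. H k (fst z) (snd z) \<partial>?P))"
    unfolding J_def by (simp add: nn_integral_cmult nn_integral_suminf)
  also have "\<dots> \<le> ennreal (suminf w) * (\<Sum>k. ennreal ((b k)\<^sup>2 / w k * G k))"
  proof (intro mult_left_mono suminf_le)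
    fix k
    have "(\<integral>\<^sup>+ z. H k (fst z) (snd z) \<partial>?P) = (\<integral>\<^sup>+ y. (\<integral>\<^sup>+ x. H k x y \<partial>\<nu>) \<partial>\<nu>)"
      by (subst nn_integral_snd[symmetric]) auto
    also have "\<dots> \<le> ennreal (G k)" unfolding H_def by (rule energy)
    finally have "ennreal ((b k)\<^sup>2 / w k) * (\<integral>\<^sup>+ z. H k (fst z) (snd z) \<partial>?P)
        \<le> ennreal ((b k)\<^sup>2 / w k) * ennreal (G k)"
      by (rule mult_left_mono) simp
    then show "ennreal ((b k)\<^sup>2 / w k) * (\<integral>\<^sup>+ z. H k (fst z) (snd z) \<partial>?P)
        \<le> ennreal ((b k)\<^sup>2 / w k * G k)"
      using w(1)[of k] G(1)[of k] by (subst ennreal_mult) auto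
  qed auto
  also have "\<dots> = ennreal (suminf w) * ennreal (\<Sum>k. (b k)\<^sup>2 / w k * G k)"
    using w(1) G by (subst suminf_ennreal2) (auto simp: less_imp_le)
  also have "\<dots> < \<infinity>" by (simp add: ennreal_mult_less_top)
  finally show ?thesis .
qed

text \<open>The parallelogram law always offers one sign for which the new term is not cancelled by the
  previous ones.\<close>

lemma exists_signs:
  assumes v: "\<And>k. v k \<in> L2 \<nu>" and t: "\<And>k. t k > 0"
    and \<kappa>: "\<And>k. \<kappa> \<le> defect (t k) (v k)"
  obtains e :: "nat \<Rightarrow> real" where "\<And>k. \<bar>e k\<bar> = 1"
    "\<And>n. (\<lambda>x. \<Sum>k<n. e k * a k * v k x) \<in> L2 \<nu>"
    "\<And>n. \<kappa> * (a n)\<^sup>2 \<le> defect (t n) (\<lambda>x. \<Sum>k<Suc n. e k * a k * v k x)"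
proof -
  define good where "good n S \<longleftrightarrow> \<kappa> * (a n)\<^sup>2 \<le> defect (t n) (\<lambda>x. S x + a n * v n x)" for n S
  \<comment> \<open>The sign at n depends on the partial sum before it, so sums and signs are built
    together. Later terms do not influence the choice; their effect is bounded by size in
    \<open>oscillating_function_exists\<close>.\<close>
  define S where "S = rec_nat (\<lambda>x. 0) (\<lambda>n S x. S x + (if good n S then 1 else - 1) * a n * v n x)"
  define e where "e n = (if good n (S n) then 1 else - 1 :: real)" for n
  have S_Suc: "S (Suc n) = (\<lambda>x. S n x + e n * a n * v n x)" for n
    by (simp add: S_def e_def)
  have S_sum: "S n = (\<lambda>x. \<Sum>k<n. e k * a k * v k x)" for n
  proof (induction n)
    case 0
    show ?case by (simp add: S_def)
  next
    case (Suc n)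
    show ?case unfolding S_Suc Suc by simp
  qed
  have S_L2: "S n \<in> L2 \<nu>" for n
  proof (induction n)
    case 0
    show ?case by (simp add: S_sum L2_zero)
  next
    case (Suc n)
    show ?case unfolding S_Suc by (intro L2_add L2_scale Suc v)
  qed
  have S_good: "\<kappa> * (a n)\<^sup>2 \<le> defect (t n) (S (Suc n))" for n
  proof (cases "good n (S n)")
    case True
    then show ?thesis by (simp add: S_Suc e_def good_def)
  next
    case False
    have "\<kappa> * (a n)\<^sup>2 \<le> (a n)\<^sup>2 * defect (t n) (v n)"
      using mult_right_mono[OF \<kappa>[of n], of "(a n)\<^sup>2"] by (simp add: mult.commute)
    then have "\<kappa> * (a n)\<^sup>2 \<le> defect (t n) (\<lambda>x. S n x - a n * v n x)"
      using defect_parallelogram[OF t[of n] S_L2[of n] v, of "a n" n] False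
        defect_nonneg[OF t S_L2, of n n]
      unfolding good_def by linarith
    then show ?thesis using False by (simp add: S_Suc e_def)
  qed
  show thesis
  proof (rule that[of e])
    fix n
    show "\<bar>e n\<bar> = 1" by (simp add: e_def)
    show "(\<lambda>x. \<Sum>k<n. e k * a k * v k x) \<in> L2 \<nu>"
      using S_L2[of n] unfolding S_sum .
    show "\<kappa> * (a n)\<^sup>2 \<le> defect (t n) (\<lambda>x. \<Sum>k<Suc n. e k * a k * v k x)"
      using S_good[of n] unfolding S_sum .
  qed
qed

section \<open>Assembling the oscillating function\<close>

lemma oscillating_function_exists:
  obtains u where "u \<in> L2 \<nu>" "\<And>\<beta>. 0 < \<beta> \<Longrightarrow> \<beta> < \<beta>0 \<Longrightarrow> u \<in> F_space \<alpha> \<nu> \<beta>"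
    "\<And>L. \<exists>t>0. L * t < defect t u"
proof -
  obtain A \<kappa> B \<rho> where AB: "A > 0" "\<kappa> > 0" "B > 0" "\<rho> > 0"
    and bump: "\<And>\<tau>. 0 < \<tau> \<Longrightarrow> \<tau> < \<rho> \<Longrightarrow> \<exists>v\<in>L2 \<nu>. L2_inner \<nu> v v \<le> 1 \<and> \<kappa> \<le> defect (A * \<tau>) v \<and>
      (\<forall>t>0. defect t v \<le> B * t / \<tau>)"
    using bump_exists by blast
  \<comment> \<open>\<kappa> bounds from below a defect that is at most the squared norm of a bump,
    hence at most 1.\<close>
  have \<kappa>1: "\<kappa> \<le> 1"
  proof -
    obtain v where "v \<in> L2 \<nu>" "L2_inner \<nu> v v \<le> 1" "\<kappa> \<le> defect (A * (\<rho> / 2)) v"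
      using bump[of "\<rho> / 2"] AB by auto
    then show ?thesis using defect_le[of "A * (\<rho> / 2)" v] AB by simp
  qed
  \<comment> \<open>The first bound keeps every \<tau>_n within reach of \<open>bump\<close>, the
    second keeps the lengths \<tau>_n^(1/\<beta>0) below R.\<close>
  define \<sigma> where "\<sigma> = min (\<rho> / 2) ((R / 2) powr \<beta>0)"
  have \<sigma>: "\<sigma> > 0" "\<sigma> < \<rho>" "\<sigma> \<le> (R / 2) powr \<beta>0"
    using AB pos by (auto simp: \<sigma>_def)
  \<comment> \<open>Chosen so that the tail bound 4 s a_n has square \<kappa>^2/4 a_n^2 <=
    \<kappa>/4 a_n^2.\<close>
  define s where "s = \<kappa> / 8"
  have s: "0 < s" "s \<le> 1 / 8" using AB \<kappa>1 by (auto simp: s_def)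
  define \<tau> where "\<tau> n = \<sigma> * (s\<^sup>2) ^ n" for n :: nat
  have s2: "0 < s\<^sup>2" "s\<^sup>2 < 1" using s by (auto simp: power_less_one_iff abs_square_less_1)
  have \<tau>: "\<tau> n > 0" "\<tau> n \<le> \<sigma>" for n
    using mult_pos_pos[OF \<sigma>(1) zero_less_power[OF s2(1), of n]]
      mult_left_le[OF power_le_one[OF less_imp_le[OF s2(1)] less_imp_le[OF s2(2)]] less_imp_le[OF \<sigma>(1)]]
    by (auto simp: \<tau>_def)
  define a where "a n = sqrt \<sigma> * (real (Suc n) * s ^ n)" for n :: nat
  have a: "a n > 0" for n using \<sigma> s by (simp add: a_def)
  have a2: "(a n)\<^sup>2 = (real (Suc n))\<^sup>2 * \<tau> n" for n
    using \<sigma> by (simp add: a_def \<tau>_def power_mult_distrib power_mult[symmetric] mult_ac)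
  have summ_a: "summable a"
    unfolding a_def using summable_power_times_geometric[of s 1] s by (intro summable_mult) simp
  have "\<exists>v\<in>L2 \<nu>. L2_inner \<nu> v v \<le> 1 \<and> \<kappa> \<le> defect (A * \<tau> n) v \<and> (\<forall>t>0. defect t v \<le> B * t / \<tau> n)" for n
    using \<tau>[of n] \<sigma> by (intro bump) auto
  then obtain v where v: "\<And>n. v n \<in> L2 \<nu>" "\<And>n. L2_inner \<nu> (v n) (v n) \<le> 1"
    "\<And>n. \<kappa> \<le> defect (A * \<tau> n) (v n)" "\<And>n t. t > 0 \<Longrightarrow> defect t (v n) \<le> B * t / \<tau> n"
    by metis
  obtain e :: "nat \<Rightarrow> real" where e: "\<And>k. \<bar>e k\<bar> = 1"
    and S: "\<And>n. (\<lambda>x. \<Sum>k<n. e k * a k * v k x) \<in> L2 \<nu>"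
    and S_defect: "\<And>n. \<kappa> * (a n)\<^sup>2 \<le> defect (A * \<tau> n) (\<lambda>x. \<Sum>k<Suc n. e k * a k * v k x)"
    using exists_signs[of v "\<lambda>n. A * \<tau> n" \<kappa> a] v AB \<tau> by auto
  define u where "u x = (\<Sum>k. e k * a k * v k x)" for x
  have u_L2: "u \<in> L2 \<nu>" and u_summ: "AE x in \<nu>. summable (\<lambda>k. e k * a k * v k x)"
    using L2_series[of v a e] v a summ_a e by (auto simp: u_def[abs_def])
  \<comment> \<open>From (k+2)/(k+1) <= 2 follows a_(k+1) <= 2 s a_k, and 2 s <= 1/4 makes the tail
    geometrically dominated.\<close>
  have tail_a: "(\<Sum>k. a (k + Suc n)) \<le> 4 * s * a n" for n
  proof -
    have step: "a (Suc k) \<le> 2 * s * a k" for k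
    proof -
      have "real (Suc (Suc k)) * (sqrt \<sigma> * s ^ Suc k) \<le> (2 * real (Suc k)) * (sqrt \<sigma> * s ^ Suc k)"
        using \<sigma> s by (intro mult_right_mono) auto
      then show ?thesis by (simp add: a_def mult_ac)
    qed
    have le: "a (k + Suc n) \<le> 2 * s * a n * (1 / 4) ^ k" for k
    proof (induction k)
      case 0
      show ?case using step[of n] by simp
    next
      case (Suc k)
      have "2 * s * a (k + Suc n) \<le> 1 / 4 * a (k + Suc n)"
        using s a[of "k + Suc n"] by (intro mult_right_mono) auto
      with step[of "k + Suc n"] have "a (Suc k + Suc n) \<le> 1 / 4 * a (k + Suc n)" by simp
      with Suc show ?case by simp
    qed
    have geo: "(\<lambda>k. 2 * s * a n * (1 / 4) ^ k) sums (2 * s * a n * (1 / (1 - 1 / 4)))"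
      by (intro sums_mult geometric_sums) simp
    have "(\<Sum>k. a (k + Suc n)) \<le> (\<Sum>k. 2 * s * a n * (1 / 4) ^ k)"
      using le summ_a geo by (intro suminf_le) (auto simp: summable_iff_shift sums_iff simp del: add_Suc_right)
    also have "\<dots> = 2 * s * a n * (4 / 3)" using geo by (simp add: sums_iff)
    also have "\<dots> \<le> 4 * s * a n" using s a[of n] by simp
    finally show ?thesis .
  qed
  \<comment> \<open>With r the tail and S = u - r: \<kappa> a_n^2 <= h(S) <= 2 h(u) + 2 h(r), and
    h(r) <= (r,r) <= \<kappa>/4 a_n^2, which leaves h(u) >= \<kappa>/4 a_n^2.\<close>
  have u_defect: "\<kappa> / 4 * (a n)\<^sup>2 \<le> defect (A * \<tau> n) u" for n
  proof -
    let ?S = "\<lambda>x. \<Sum>k<Suc n. e k * a k * v k x"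
    let ?r = "\<lambda>x. \<Sum>k. e (k + Suc n) * a (k + Suc n) * v (k + Suc n) x"
    have t: "A * \<tau> n > 0" using AB \<tau> by simp
    have d: "(\<lambda>x. u x - ?S x) \<in> L2 \<nu>" by (intro L2_diff u_L2 S)
    have r: "?r \<in> L2 \<nu>" "L2_inner \<nu> ?r ?r \<le> (\<Sum>k. a (k + Suc n))\<^sup>2"
      using L2_series[of "\<lambda>k. v (k + Suc n)" "\<lambda>k. a (k + Suc n)" "\<lambda>k. e (k + Suc n)"] v a summ_a e
      by (auto simp: summable_iff_shift simp del: add_Suc_right)
    \<comment> \<open>The tail splits off where the series converges, hence almost
      everywhere.\<close>
    have AE: "AE x in \<nu>. u x - ?S x = ?r x"
      using u_summ
    proof eventually_elim
      case (elim x)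
      from suminf_split_initial_segment[OF this, of "Suc n"] show ?case
        by (simp add: u_def)
    qed
    have "L2_inner \<nu> (\<lambda>x. u x - ?S x) (\<lambda>x. u x - ?S x) = L2_inner \<nu> ?r ?r"
      unfolding L2_inner_def
    proof (rule integral_cong_AE)
      show "AE x in \<nu>. (u x - ?S x) * (u x - ?S x) = ?r x * ?r x"
        using AE by eventually_elim simp
    qed (use L2_measurable[OF d] L2_measurable[OF r(1)] in measurable)
    also have "\<dots> \<le> (4 * s * a n)\<^sup>2"
    proof -
      have "0 \<le> (\<Sum>k. a (k + Suc n))"
        using a summ_a by (intro suminf_nonneg) (auto simp: summable_iff_shift less_imp_le simp del: add_Suc_right)
      then show ?thesis using r(2) power_mono[OF tail_a, of n 2] by linarith
    qed
    also have "\<dots> = \<kappa> * \<kappa> / 4 * (a n)\<^sup>2" by (simp add: s_def power2_eq_square)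
    also have "\<dots> \<le> \<kappa> * 1 / 4 * (a n)\<^sup>2"
      using AB \<kappa>1 by (intro mult_right_mono divide_right_mono mult_left_mono) auto
    finally have "defect (A * \<tau> n) (\<lambda>x. u x - ?S x) \<le> \<kappa> / 4 * (a n)\<^sup>2"
      using defect_le[OF t d] by simp
    moreover have "defect (A * \<tau> n) ?S
        \<le> 2 * defect (A * \<tau> n) u + 2 * defect (A * \<tau> n) (\<lambda>x. u x - ?S x)"
      using defect_add_le[OF t u_L2 d, of 1 "-1"] by simp
    ultimately show ?thesis using S_defect[of n] by linarith
  qed
  \<comment> \<open>At t = A \<tau>_n the quotient h_t(u)/t is at least \<kappa> (n+1)^2 / (4
    A).\<close>
  have unbounded: "\<exists>t>0. L * t < defect t u" for L
  proof -
    obtain n :: nat where n: "real n > 4 * L * A / \<kappa>" using reals_Archimedean2 by blast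
    have "L * A < \<kappa> / 4 * real n" using n AB by (simp add: field_simps)
    also have "\<dots> \<le> \<kappa> / 4 * (real (Suc n))\<^sup>2"
    proof -
      have "real n \<le> real (Suc n) * 1" by simp
      also have "\<dots> \<le> real (Suc n) * real (Suc n)" by (intro mult_left_mono) auto
      finally show ?thesis using AB by (intro mult_left_mono) (auto simp: power2_eq_square)
    qed
    finally have "L * A * \<tau> n < \<kappa> / 4 * (real (Suc n))\<^sup>2 * \<tau> n"
      using \<tau> by (intro mult_strict_right_mono)
    also have "\<dots> = \<kappa> / 4 * (a n)\<^sup>2" by (simp add: a2)
    also note u_defect
    finally show ?thesis using AB \<tau> by (intro exI[of _ "A * \<tau> n"]) (auto simp: mult.assoc)
  qed
  have "u \<in> F_space \<alpha> \<nu> \<beta>" if \<beta>: "0 < \<beta>" "\<beta> < \<beta>0" for \<beta>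
  proof -
    obtain K where K: "K > 0"
      and bound: "\<And>u r0 L. \<lbrakk>u \<in> L2 \<nu>; 0 < r0; r0 < R; 0 \<le> L;
        \<And>r. 0 < r \<Longrightarrow> r \<le> r0 \<Longrightarrow> defect (r powr \<beta>0) u \<le> L * r powr \<beta>0\<rbrakk> \<Longrightarrow>
        (\<integral>\<^sup>+ y. (\<integral>\<^sup>+ x. ennreal ((u x - u y)\<^sup>2 / dist x y powr (\<alpha> + \<beta>)) \<partial>\<nu>) \<partial>\<nu>)
        \<le> ennreal (K * (L * r0 powr (\<beta>0 - \<beta>) + L2_inner \<nu> u u * r0 powr (- \<beta>)))"
      using singular_energy_bound[OF \<beta>] by blast
    define \<theta> where "\<theta> = \<beta> / \<beta>0"
    have \<theta>: "0 < 1 - \<theta>" using \<beta> by (simp add: \<theta>_def)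
    define G where "G k = K * (B + 1) * \<tau> k powr (- \<theta>)" for k
    have energy: "(\<integral>\<^sup>+ y. (\<integral>\<^sup>+ x. ennreal ((v k x - v k y)\<^sup>2 / dist x y powr (\<alpha> + \<beta>)) \<partial>\<nu>) \<partial>\<nu>)
        \<le> ennreal (G k)" for k
    proof -
      \<comment> \<open>This length balances the energy bound: with L = B/\<tau>_k both of its terms
        become multiples of \<tau>_k^(-\<theta>).\<close>
      define r0 where "r0 = \<tau> k powr (1 / \<beta>0)"
      have r0: "r0 > 0" using \<tau>[of k] by (simp add: r0_def)
      have "r0 \<le> ((R / 2) powr \<beta>0) powr (1 / \<beta>0)"
        unfolding r0_def using \<tau>[of k] \<sigma> pos by (intro powr_mono2) auto
      also have "\<dots> = R / 2" using pos by (simp add: powr_powr)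
      finally have "r0 < R" using pos by simp
      have e1: "r0 powr (- \<beta>) = \<tau> k powr (- \<theta>)"
        by (simp add: r0_def powr_powr \<theta>_def)
      have "r0 powr (\<beta>0 - \<beta>) = \<tau> k powr (1 - \<theta>)"
        using pos by (simp add: r0_def powr_powr \<theta>_def diff_divide_distrib)
      also have "\<dots> = \<tau> k * \<tau> k powr (- \<theta>)"
        using \<tau>[of k] powr_add[of "\<tau> k" 1 "- \<theta>"] by simp
      finally have e2: "r0 powr (\<beta>0 - \<beta>) = \<tau> k * \<tau> k powr (- \<theta>)" .
      have "(\<integral>\<^sup>+ y. (\<integral>\<^sup>+ x. ennreal ((v k x - v k y)\<^sup>2 / dist x y powr (\<alpha> + \<beta>)) \<partial>\<nu>) \<partial>\<nu>)
        \<le> ennreal (K * (B / \<tau> k * r0 powr (\<beta>0 - \<beta>) + L2_inner \<nu> (v k) (v k) * r0 powr (- \<beta>)))"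
        using v(4)[of _ k] AB \<tau>[of k] by (intro bound v r0 \<open>r0 < R\<close>) auto
      also have "\<dots> \<le> ennreal (K * (B / \<tau> k * r0 powr (\<beta>0 - \<beta>) + 1 * r0 powr (- \<beta>)))"
        using K v(2)[of k] by (intro ennreal_leI mult_left_mono add_left_mono mult_right_mono) auto
      also have "K * (B / \<tau> k * r0 powr (\<beta>0 - \<beta>) + 1 * r0 powr (- \<beta>)) = G k"
        unfolding e1 e2 G_def using \<tau>(1)[of k] by (simp add: algebra_simps)
      finally show ?thesis .
    qed
    \<comment> \<open>Summable weights that cost a factor (k+1)^2. Together with the (k+1)^2 in
      a_k^2, the weighted energies are multiples of (k+1)^4 z^k with z = s^(2(1-\<theta>)), and z <
      1 because \<beta> < \<beta>0.\<close>
    define w where "w k = 1 / (real (Suc k))\<^sup>2" for k :: nat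
    have w: "w k > 0" for k by (simp add: w_def)
    have summ_w: "summable w"
      unfolding w_def using inverse_power_summable[of 2, where 'a = real]
      by (subst summable_Suc_iff[where f = "\<lambda>k. 1 / (real k)\<^sup>2"]) (simp add: inverse_eq_divide)
    define z where "z = (s\<^sup>2) powr (1 - \<theta>)"
    have z: "0 < z" "z < 1"
      using s2 \<theta> powr_less_mono2[of "1 - \<theta>" "s\<^sup>2" 1] by (auto simp: z_def)
    have "summable (\<lambda>k. (e k * a k)\<^sup>2 / w k * G k)"
    proof -
      have "(e k * a k)\<^sup>2 / w k * G k = K * (B + 1) * \<sigma> powr (1 - \<theta>) * (real (Suc k) ^ 4 * z ^ k)" for k
      proof -
        have "(e k)\<^sup>2 = 1" using e[of k] by (simp add: abs_square_eq_1)
        then have "(e k * a k)\<^sup>2 / w k * G k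
          = K * (B + 1) * real (Suc k) ^ 4 * (\<tau> k * \<tau> k powr (- \<theta>))"
          by (simp only: power_mult_distrib a2 w_def G_def) (simp add: power2_eq_square power4_eq_xxxx mult_ac)
        also have "\<tau> k * \<tau> k powr (- \<theta>) = \<tau> k powr (1 - \<theta>)"
          using \<tau>[of k] powr_add[of "\<tau> k" 1 "- \<theta>"] by simp
        also have "\<dots> = \<sigma> powr (1 - \<theta>) * z ^ k"
        proof -
          have "((s\<^sup>2) ^ k) powr (1 - \<theta>) = z ^ k"
            unfolding z_def using s2
            by (simp only: powr_realpow[symmetric] powr_powr powr_gt_zero)
              (simp add: mult.commute powr_powr powr_realpow[symmetric])
          then show ?thesis using \<sigma> by (simp add: \<tau>_def powr_mult)
        qed
        finally show ?thesis by (simp add: mult_ac)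
      qed
      then show ?thesis
        using summable_power_times_geometric[OF z, of 4] by (simp add: summable_mult)
    qed
    then have "(\<integral>\<^sup>+ y. (\<integral>\<^sup>+ x. ennreal ((u x - u y)\<^sup>2 / dist x y powr (\<alpha> + \<beta>)) \<partial>\<nu>) \<partial>\<nu>) < \<infinity>"
      using K AB
      by (intro singular_energy_series[OF v(1) u_summ w summ_w energy])
        (auto simp: G_def u_def[abs_def])
    with u_L2 show ?thesis by (simp add: F_space_def)
  qed
  with u_L2 unbounded that show thesis by blast
qed

end

subsection \<open>Reduction to the abstract estimates\<close>

text \<open>For decreasing \<Phi> the extended limit at 0+ exists and is the supremum, so
  \<open>Lim\<close> has its intended value and the comparison extends to argument 0.\<close>

lemma ext0_antimono:
  assumes "antimono_on {0<..} \<Phi>" "0 \<le> s" "s \<le> s'"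
  shows "ext0 \<Phi> s' \<le> ext0 \<Phi> s"
proof -
  have anti: "\<Phi> b \<le> \<Phi> a" if "0 < a" "a \<le> b" for a b
    using assms(1) that by (auto simp: monotone_on_def)
  define m where "m = (SUP r\<in>{0<..}. ennreal (\<Phi> r))"
  have "((\<lambda>r. ennreal (\<Phi> r)) \<longlongrightarrow> m) (at_right 0)"
  proof (rule order_tendstoI)
    fix a assume "a < m"
    then obtain r where r: "r > 0" "a < ennreal (\<Phi> r)" by (auto simp: m_def less_SUP_iff)
    then have "a < ennreal (\<Phi> s)" if "0 < s" "s < r" for s
      using anti[of s r] that by (auto intro: less_le_trans ennreal_leI)
    then show "\<forall>\<^sub>F s in at_right 0. a < ennreal (\<Phi> s)"
      using r(1) by (auto simp: eventually_at_right_field)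
  next
    fix a assume "m < a"
    have "ennreal (\<Phi> s) < a" if "s > 0" for s
    proof -
      have "ennreal (\<Phi> s) \<le> m" unfolding m_def by (rule SUP_upper) (use that in simp)
      then show ?thesis using \<open>m < a\<close> by (rule le_less_trans)
    qed
    then show "\<forall>\<^sub>F s in at_right 0. ennreal (\<Phi> s) < a"
      by (simp add: eventually_at_filter)
  qed
  then have lim: "Lim (at_right 0) (\<lambda>r. ennreal (\<Phi> r)) = m"
    by (intro tendsto_Lim) auto
  show ?thesis
  proof (cases "s > 0")
    case True
    then show ?thesis using anti[of s s'] assms by (auto simp: ext0_def intro: ennreal_leI)
  next
    case False
    then show ?thesis using assms by (auto simp: ext0_def lim m_def intro: SUP_upper)
  qed
qed

text \<open>Relatively compact balls have finite Radon measure, and those of integer radius about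
  one point exhaust the space.\<close>

lemma sigma_finite_of_proper_balls:
  fixes \<nu> :: "'a::metric_space measure"
  assumes "radon_measure \<nu>" "\<And>(x :: 'a) r. compact (closure (ball x r))"
  shows "emeasure \<nu> (ball x r) < \<infinity>" and "sigma_finite_measure \<nu>"
proof -
  have sets: "sets \<nu> = sets borel" and fin: "\<And>S. compact S \<Longrightarrow> emeasure \<nu> S < \<infinity>"
    using assms(1) unfolding radon_measure_def by blast+
  show ball_fin: "emeasure \<nu> (ball x r) < \<infinity>" for x r
  proof -
    have "emeasure \<nu> (ball x r) \<le> emeasure \<nu> (closure (ball x r))"
      using closure_subset by (intro emeasure_mono) (auto simp: sets)
    then show ?thesis using fin[OF assms(2)[of x r]] by (rule le_less_trans)
  qed
  define x0 :: 'a where "x0 = undefined"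
  have "(\<Union>n::nat. ball x0 (real n)) = UNIV"
    using reals_Archimedean2 by (auto simp: mem_ball)
  then show "sigma_finite_measure \<nu>"
    using ball_fin[of x0] sets sets_eq_imp_space_eq[OF sets]
    by (intro sigma_finite_measure.intro exI[of _ "range (\<lambda>n::nat. ball x0 (real n))"])
      (auto simp: less_top)
qed

lemma (in heat_kernel_estimates) F_space_if_defect_linear:
  assumes u: "u \<in> L2 \<nu>" and L: "0 \<le> L" "\<And>t. t > 0 \<Longrightarrow> defect t u \<le> L * t"
    and \<beta>: "0 < \<beta>" "\<beta> < \<beta>0"
  shows "u \<in> F_space \<alpha> \<nu> \<beta>"
proof -
  obtain K where "K > 0" and K: "\<And>u r0 L. \<lbrakk>u \<in> L2 \<nu>; 0 < r0; r0 < R; 0 \<le> L;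
      \<And>r. 0 < r \<Longrightarrow> r \<le> r0 \<Longrightarrow> defect (r powr \<beta>0) u \<le> L * r powr \<beta>0\<rbrakk> \<Longrightarrow>
      (\<integral>\<^sup>+ y. (\<integral>\<^sup>+ x. ennreal ((u x - u y)\<^sup>2 / dist x y powr (\<alpha> + \<beta>)) \<partial>\<nu>) \<partial>\<nu>)
      \<le> ennreal (K * (L * r0 powr (\<beta>0 - \<beta>) + L2_inner \<nu> u u * r0 powr (- \<beta>)))"
    using singular_energy_bound[OF \<beta>] by blast
  have "(\<integral>\<^sup>+ y. (\<integral>\<^sup>+ x. ennreal ((u x - u y)\<^sup>2 / dist x y powr (\<alpha> + \<beta>)) \<partial>\<nu>) \<partial>\<nu>)
      \<le> ennreal (K * (L * (R / 2) powr (\<beta>0 - \<beta>) + L2_inner \<nu> u u * (R / 2) powr (- \<beta>)))"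
    using pos L by (intro K u) auto
  also have "\<dots> < \<infinity>" by simp
  finally show ?thesis using u by (simp add: F_space_def)
qed

theorem proposition1p3:
  fixes \<nu> :: "'a::{metric_space, second_countable_topology} measure"
    and E :: "('a \<Rightarrow> real) \<Rightarrow> ('a \<Rightarrow> real) \<Rightarrow> real"
    and F :: "('a \<Rightarrow> real) set"
    and T :: "real \<Rightarrow> ('a \<Rightarrow> real) \<Rightarrow> 'a \<Rightarrow> real"
    and p :: "real \<Rightarrow> 'a \<Rightarrow> 'a \<Rightarrow> real"
    and \<Phi> :: "real \<Rightarrow> real"
    and \<alpha> \<beta>0 C1 C2 C3 C4 :: real
  assumes "regular_mms \<alpha> \<nu>"
    and "\<exists>x y :: 'a. x \<noteq> y"
    and "chain_condition (UNIV :: 'a set)"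
    and "\<And>(x :: 'a) r. compact (closure (ball x r))"
    and "dirichlet_form \<nu> E F"
    and "regular_form \<nu> E F"
    and "semigroup_of_form \<nu> E F T"
    and "heat_kernel \<nu> T p"
    and "conservative_kernel \<nu> p"
    and "\<beta>0 > 0"
    and "C1 > 0" "C2 > 0" "C3 > 0" "C4 > 0"
    and "\<And>s. s > 0 \<Longrightarrow> \<Phi> s > 0"
    and "antimono_on {0<..} \<Phi>"
    and "\<And>x y t. \<lbrakk>0 < t; ereal t < epowr (ediameter (UNIV :: 'a set)) \<beta>0\<rbrakk> \<Longrightarrow>
           ennreal (C1 / t powr (\<alpha> / \<beta>0)) * ext0 \<Phi> (C2 * (dist x y / t powr (1 / \<beta>0)))
             \<le> ennreal (p t x y)"
    and "\<And>x y t. \<lbrakk>0 < t; ereal t < epowr (ediameter (UNIV :: 'a set)) \<beta>0\<rbrakk> \<Longrightarrow>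
           ennreal (p t x y)
             \<le> ennreal (C3 / t powr (\<alpha> / \<beta>0)) * ext0 \<Phi> (C4 * (dist x y / t powr (1 / \<beta>0)))"
  shows "F \<subset> (\<Inter>\<beta>\<in>{0<..<\<beta>0}. F_space \<alpha> \<nu> \<beta>)"
proof -
  note lower = assms(17) and upper = assms(18)
  have \<beta>0: "\<beta>0 > 0" and C: "C1 > 0" "C2 > 0" "C3 > 0" "C4 > 0"
    and \<Phi>: "\<And>s. s > 0 \<Longrightarrow> \<Phi> s > 0" and anti: "antimono_on {0<..} \<Phi>"
    by (fact assms)+
  have \<alpha>: "\<alpha> > 0" and radon: "radon_measure \<nu>"
    using assms(1) by (auto simp: regular_mms_def metric_measure_space_def)
  then have sets: "sets \<nu> = sets borel" by (simp add: radon_measure_def)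
  note balls = sigma_finite_of_proper_balls[OF radon assms(4)]
  define D where "D = ediameter (UNIV :: 'a set)"
  have dist_D: "ereal (dist x y) \<le> D" for x y :: 'a
    unfolding D_def ediameter_def by (intro SUP_upper2[of x] SUP_upper) auto
  obtain x1 y1 :: 'a where "x1 \<noteq> y1" using assms(2) by blast
  then have "0 < ereal (dist x1 y1)" by simp
  then have D0: "0 < D" using dist_D[of x1 y1] by (rule less_le_trans)
  obtain C where "C > 0"
    and reg: "\<And>x r. 0 < r \<Longrightarrow> ereal r < D \<Longrightarrow> ennreal (r powr \<alpha> / C) \<le> emeasure \<nu> (ball x r)
      \<and> emeasure \<nu> (ball x r) \<le> ennreal (C * r powr \<alpha>)"
    using assms(1) unfolding regular_mms_def D_def by blast
  \<comment> \<open>Every positive length below R is admissible in the regularity and kernel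
    assumptions; on an unbounded space the value 1 is arbitrary.\<close>
  define R where "R = (if D = \<infinity> then 1 else real_of_ereal D)"
  have R: "R > 0" using D0 by (cases D) (auto simp: R_def)
  have rD: "ereal r < D" if "r < R" for r
    using that D0 by (cases D) (auto simp: R_def)
  have tD: "ereal (r powr \<beta>0) < epowr D \<beta>0" if "0 < r" "r < R" for r
    using that D0 \<beta>0 by (cases D) (auto simp: R_def epowr_def intro!: powr_less_mono2)
  obtain V where V: "V > 0" "C \<le> V"
    and ball_upper: "\<And>x r. 0 < r \<Longrightarrow> emeasure \<nu> (ball x r) \<le> ennreal (V * r powr \<alpha>)"
  proof (cases "D = \<infinity>")
    case True
    then show thesis using that[of C] \<open>C > 0\<close> reg by auto
  next
    case False
    have "dist x1 y < R + 1" for y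
      using dist_D[of x1 y] False D0 by (cases D) (auto simp: R_def)
    then have "UNIV = ball x1 (R + 1)" by auto
    then have fin: "emeasure \<nu> UNIV < \<infinity>" using balls(1) by metis
    define m where "m = measure \<nu> UNIV"
    have em: "emeasure \<nu> UNIV = ennreal m"
      using fin by (simp add: m_def emeasure_eq_ennreal_measure)
    have m: "m \<ge> 0" by (simp add: m_def)
    \<comment> \<open>Regularity stops at the diameter. A larger ball has at most the total mass m,
      and r >= R gives m <= (m / R^\<alpha>) r^\<alpha>.\<close>
    define V where "V = C + m / R powr \<alpha>"
    show thesis
    proof (rule that[of V])
      show "V > 0" "C \<le> V" using \<open>C > 0\<close> m by (auto simp: V_def add_pos_nonneg)
      fix x :: 'a and r :: real assume r: "0 < r"
      show "emeasure \<nu> (ball x r) \<le> ennreal (V * r powr \<alpha>)"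
      proof (cases "r < R")
        case True
        have "C * r powr \<alpha> \<le> V * r powr \<alpha>"
          using \<open>C \<le> V\<close> by (intro mult_right_mono) auto
        then show ?thesis using reg[OF r rD[OF True], of x] by (meson ennreal_leI order_trans)
      next
        case False
        have "emeasure \<nu> (ball x r) \<le> ennreal m"
          unfolding em[symmetric] by (intro emeasure_mono) (auto simp: sets)
        also have "m \<le> V * r powr \<alpha>"
        proof -
          have "m = m / R powr \<alpha> * R powr \<alpha>" using R by simp
          also have "\<dots> \<le> V * r powr \<alpha>"
            using False R \<alpha> m \<open>C > 0\<close> by (intro mult_mono powr_mono2) (auto simp: V_def)
          finally show ?thesis .
        qed
        finally show ?thesis by (simp add: ennreal_leI)
      qed
    qed
  qed
  have pw: "(r powr \<beta>0) powr (\<alpha> / \<beta>0) = r powr \<alpha>" "(r powr \<beta>0) powr (1 / \<beta>0) = r"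
    if "0 < r" for r
    using that \<beta>0 by (simp_all add: powr_powr)
  have low: "ennreal (C1 * r powr (- \<alpha>)) * ext0 \<Phi> (C2 * (dist x y / r)) \<le> ennreal (p (r powr \<beta>0) x y)"
    if "0 < r" "r < R" for r x y
    using lower[of "r powr \<beta>0" x y] tD[OF that] that unfolding pw[OF that(1)]
    by (simp add: D_def powr_minus divide_inverse)
  have up: "ennreal (p (r powr \<beta>0) x y) \<le> ennreal (C3 * r powr (- \<alpha>)) * ext0 \<Phi> (C4 * (dist x y / r))"
    if "0 < r" "r < R" for r x y
    using upper[of "r powr \<beta>0" x y] tD[OF that] that unfolding pw[OF that(1)]
    by (simp add: D_def powr_minus divide_inverse)
  have p0: "0 \<le> p t x y" if "t > 0" for t x y
    using assms(8) that by (simp add: heat_kernel_def)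
  \<comment> \<open>The lower kernel bound on the diagonal forces this, because the kernel takes
    real values there.\<close>
  have "ext0 \<Phi> 0 < \<infinity>"
  proof -
    have "ennreal (C1 * (R / 2) powr (- \<alpha>)) * ext0 \<Phi> 0 < \<infinity>"
      using le_less_trans[OF low[of "R / 2" x1 x1]] R by simp
    moreover have "ennreal (C1 * (R / 2) powr (- \<alpha>)) > 0" using R C by simp
    ultimately show ?thesis by (auto simp: ennreal_mult_less_top)
  qed
  then obtain m where m: "ext0 \<Phi> 0 = ennreal m" "m \<ge> 0"
    by (cases "ext0 \<Phi> 0") auto
  have "ennreal (\<Phi> 1) \<le> ennreal m"
    using ext0_antimono[OF anti, of 0 1] by (simp add: ext0_def[of _ 1] m)
  then have "m > 0" using \<Phi>[of 1] m by simp
  \<comment> \<open>For d(x,y) <= r the argument of \<Phi> in the lower bound is at most C2, and in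
    the upper bound it is always at least 0; monotonicity then gives the constants C1 \<Phi>(C2) and
    C3 \<Phi>(0+).\<close>
  have est: "heat_kernel_estimates \<nu> T p \<alpha> \<beta>0 (C1 * \<Phi> C2) (C3 * m) V R"
  proof (intro heat_kernel_estimates.intro L2_semigroup.intro heat_kernel_estimates_axioms.intro)
    show "markovian_semigroup \<nu> T" using assms(7) by (simp add: semigroup_of_form_def)
    show "sets \<nu> = sets borel" "sigma_finite_measure \<nu>" "heat_kernel \<nu> T p"
      "conservative_kernel \<nu> p" "\<alpha> > 0" "\<beta>0 > 0" "V > 0" "R > 0"
      by (fact sets balls(2) assms(8,9) \<alpha> \<beta>0 V(1) R)+
    show "0 < C1 * \<Phi> C2" "0 < C3 * m" using C \<Phi> \<open>m > 0\<close> by auto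
    show "emeasure \<nu> (ball x r) \<le> ennreal (V * r powr \<alpha>)" if "0 < r" for r x
      by (rule ball_upper[OF that])
    show "ennreal (r powr \<alpha> / V) \<le> emeasure \<nu> (ball x r)" if r: "0 < r" "r < R" for r x
    proof -
      have "r powr \<alpha> / V \<le> r powr \<alpha> / C" using V \<open>C > 0\<close> by (intro divide_left_mono) auto
      then show ?thesis using reg[OF r(1) rD[OF r(2)], of x] by (meson ennreal_leI order_trans)
    qed
    show "C1 * \<Phi> C2 * r powr (- \<alpha>) \<le> p (r powr \<beta>0) x y"
      if r: "0 < r" "r < R" "dist x y \<le> r" for r x y
    proof -
      have "ext0 \<Phi> C2 \<le> ext0 \<Phi> (C2 * (dist x y / r))"
        using r C by (intro ext0_antimono[OF anti]) (auto simp: field_simps)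
      then have "ennreal (\<Phi> C2) \<le> ext0 \<Phi> (C2 * (dist x y / r))"
        using C by (simp add: ext0_def[of _ C2])
      then have "ennreal (C1 * r powr (- \<alpha>)) * ennreal (\<Phi> C2)
          \<le> ennreal (C1 * r powr (- \<alpha>)) * ext0 \<Phi> (C2 * (dist x y / r))"
        by (rule mult_left_mono) simp
      also note low[OF r(1,2)]
      finally have "ennreal (C1 * r powr (- \<alpha>) * \<Phi> C2) \<le> ennreal (p (r powr \<beta>0) x y)"
        using C \<Phi>[of C2] by (subst ennreal_mult) auto
      then show ?thesis using p0[of "r powr \<beta>0" x y] r by (simp add: mult_ac)
    qed
    show "p (r powr \<beta>0) x y \<le> C3 * m * r powr (- \<alpha>)" if r: "0 < r" "r < R" for r x y
    proof -
      note up[OF r, of x y]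
      also have "ennreal (C3 * r powr (- \<alpha>)) * ext0 \<Phi> (C4 * (dist x y / r))
          \<le> ennreal (C3 * r powr (- \<alpha>)) * ext0 \<Phi> 0"
        using r C by (intro mult_left_mono ext0_antimono[OF anti]) auto
      also have "\<dots> = ennreal (C3 * r powr (- \<alpha>) * m)"
        using C m by (simp add: ennreal_mult)
      finally have "p (r powr \<beta>0) x y \<le> C3 * r powr (- \<alpha>) * m"
        using C m by (subst (asm) ennreal_le_iff) auto
      then show ?thesis by (simp add: mult_ac)
    qed
  qed
  interpret heat_kernel_estimates \<nu> T p \<alpha> \<beta>0 "C1 * \<Phi> C2" "C3 * m" V R by (rule est)
  interpret form: closed_form_semigroup \<nu> E F T
    using assms(5,7) by unfold_locales (auto simp: dirichlet_form_def)
  have "u \<in> F_space \<alpha> \<nu> \<beta>" if "u \<in> F" "0 < \<beta>" "\<beta> < \<beta>0" for u \<beta>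
  proof (rule F_space_if_defect_linear[OF form.F_L2[OF that(1)] _ _ that(2,3)])
    show "0 \<le> 4 * E u u" using form.E_nonneg[OF that(1)] by simp
    show "defect t u \<le> 4 * E u u * t" if "t > 0" for t
      using form.defect_le_form[OF \<open>u \<in> F\<close> that] by (simp add: mult_ac)
  qed
  then have "F \<subseteq> (\<Inter>\<beta>\<in>{0<..<\<beta>0}. F_space \<alpha> \<nu> \<beta>)" by auto
  moreover obtain u where "u \<in> L2 \<nu>" and u: "\<And>\<beta>. 0 < \<beta> \<Longrightarrow> \<beta> < \<beta>0 \<Longrightarrow> u \<in> F_space \<alpha> \<nu> \<beta>"
    and unbounded: "\<And>L. \<exists>t>0. L * t < defect t u"
    using oscillating_function_exists by blast
  moreover have "u \<notin> F"
  proof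
    assume "u \<in> F"
    obtain t where "t > 0" "4 * E u u * t < defect t u" using unbounded by blast
    then show False using form.defect_le_form[OF \<open>u \<in> F\<close>, of t] by (simp add: mult_ac)
  qed
  moreover have "u \<in> (\<Inter>\<beta>\<in>{0<..<\<beta>0}. F_space \<alpha> \<nu> \<beta>)" using u by auto
  ultimately show ?thesis by blast
qed

end
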